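(* Let $n\ge 1$ and let $P$ be the Bergman projection of $L^2(B_n)$ onto $\mathbb{H}^2(B_n)$. For every $i=1,\dots,n$, the commutator $\left[\frac{\partial}{\partial z_i},P\right]$ does not admit a continuous extension to $L^2(B_n)$; that is, there is no bounded linear operator on $L^2(B_n)$ which agrees with $\frac{\partial}{\partial z_i}P-P\frac{\partial}{\partial z_i}$ on $D$.
   Context: $B_n$ is the open unit ball of $\mathbb{C}^n$, $\mu$ is Lebesgue measure on $\mathbb{C}^n$ normalized so that $\mu(B_n)=1$, and $L^2(B_n)=L^2(B_n,d\mu)$ is the space of square-integrable complex-valued functions. $\mathbb{H}^2(B_n)$ (the Bergman space) is the closed subspace of holomorphic functions in $L^2(B_n)$. The Bergman projection $P:L^2(B_n)\to\mathbb{H}^2(B_n)$ is the orthogonal projection, given by $(Pf)(z)=\int_{B_n}\frac{f(w)}{(1-z\cdot\overline{w})^{n+1}}\,d\mu(w)$ with $z\cdot\overline{w}=\sum_{j=1}^n z_j\overline{w_j}$. $D$ denotes the space of all polynomials in $z_1,\dots,z_n,\overline{z_1},\dots,\overline{z_n}$ with complex coefficients, restricted to $B_n$; it is dense in $L^2(B_n)$ and invariant under $P$ and under the derivations considered, so commutators are well defined on $D$. $\frac{\partial}{\partial z_i}$ is the Wirtinger derivative and $[X,P]=XP-PX$. *)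

theory Defs
  imports "HOL-Analysis.Analysis"
begin

abbreviation unit_ball :: "(complex ^ 'n) set" where
  "unit_ball \<equiv> ball 0 1"

definition ball_measure :: "(complex ^ 'n) measure" where
  "ball_measure = uniform_measure lebesgue unit_ball"

text \<open>
  Functions on the ball are represented by total functions on the ambient space.
  Since \<^const>\<open>ball_measure\<close> vanishes outside the ball, values there are irrelevant up to
  almost-everywhere equality, and an element of the Hilbert space of square-integrable
  functions is such a function modulo almost-everywhere equality.
\<close>

definition L2 :: "(complex ^ 'n \<Rightarrow> complex) set" where
  "L2 = {f \<in> borel_measurable ball_measure. integrable ball_measure (\<lambda>z. (cmod (f z))\<^sup>2)}"

definition L2_inner :: "(complex ^ 'n \<Rightarrow> complex) \<Rightarrow> (complex ^ 'n \<Rightarrow> complex) \<Rightarrow> complex" where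
  "L2_inner f g = (LINT z|ball_measure. f z * cnj (g z))"

definition L2_norm :: "(complex ^ 'n \<Rightarrow> complex) \<Rightarrow> real" where
  "L2_norm f = sqrt (LINT z|ball_measure. (cmod (f z))\<^sup>2)"

text \<open>
  Bounded complex-linear operators on the space of classes modulo almost-everywhere equality,
  acting on representatives.
\<close>

definition bounded_L2_operator ::
    "((complex ^ 'n \<Rightarrow> complex) \<Rightarrow> (complex ^ 'n \<Rightarrow> complex)) \<Rightarrow> bool" where
  "bounded_L2_operator T \<longleftrightarrow>
     (\<forall>f\<in>L2. T f \<in> L2) \<and>
     (\<forall>f\<in>L2. \<forall>g\<in>L2. (AE z in ball_measure. f z = g z) \<longrightarrow>
        (AE z in ball_measure. T f z = T g z)) \<and>
     (\<forall>f\<in>L2. \<forall>g\<in>L2. AE z in ball_measure. T (\<lambda>w. f w + g w) z = T f z + T g z) \<and>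
     (\<forall>c. \<forall>f\<in>L2. AE z in ball_measure. T (\<lambda>w. c * f w) z = c * T f z) \<and>
     (\<exists>C. \<forall>f\<in>L2. L2_norm (T f) \<le> C * L2_norm f)"

definition holomorphic_on_ball :: "(complex ^ 'n \<Rightarrow> complex) \<Rightarrow> bool" where
  "holomorphic_on_ball f \<longleftrightarrow>
     (\<forall>z\<in>unit_ball. \<exists>f'. (f has_derivative f') (at z) \<and> (\<forall>c v. f' (c *s v) = c * f' v))"

definition bergman_space :: "(complex ^ 'n \<Rightarrow> complex) set" where
  "bergman_space = {f \<in> L2. holomorphic_on_ball f}"

text \<open>
  The orthogonal projection onto the Bergman space. The class of the projection has exactly one
  representative that is holomorphic on the ball and vanishes off the ball; choosing it makes
  pointwise derivatives of the projection meaningful.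
\<close>

definition bergman_projection :: "(complex ^ 'n \<Rightarrow> complex) \<Rightarrow> (complex ^ 'n \<Rightarrow> complex)" where
  "bergman_projection f =
     (THE g. g \<in> bergman_space \<and> (\<forall>h\<in>bergman_space. L2_inner (\<lambda>z. f z - g z) h = 0) \<and>
        (\<forall>z. z \<notin> unit_ball \<longrightarrow> g z = 0))"

definition wirtinger :: "'n \<Rightarrow> (complex ^ 'n \<Rightarrow> complex) \<Rightarrow> (complex ^ 'n \<Rightarrow> complex)" where
  "wirtinger i f z =
     (vector_derivative (\<lambda>t. f (z + t *\<^sub>R axis i 1)) (at 0)
      - \<i> * vector_derivative (\<lambda>t. f (z + t *\<^sub>R axis i \<i>)) (at 0)) / 2"

definition polynomials :: "(complex ^ 'n \<Rightarrow> complex) set" where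
  "polynomials =
     {f. \<exists>(F :: (('n \<Rightarrow> nat) \<times> ('n \<Rightarrow> nat)) set) c. finite F \<and>
        f = (\<lambda>z. \<Sum>(\<alpha>, \<beta>)\<in>F. c \<alpha> \<beta> * (\<Prod>j\<in>UNIV. (z $ j) ^ \<alpha> j * (cnj (z $ j)) ^ \<beta> j))}"

definition commutator ::
    "((complex ^ 'n \<Rightarrow> complex) \<Rightarrow> (complex ^ 'n \<Rightarrow> complex)) \<Rightarrow>
     ((complex ^ 'n \<Rightarrow> complex) \<Rightarrow> (complex ^ 'n \<Rightarrow> complex)) \<Rightarrow>
     (complex ^ 'n \<Rightarrow> complex) \<Rightarrow> (complex ^ 'n \<Rightarrow> complex)" where
  "commutator X Y f = (\<lambda>z. X (Y f) z - Y (X f) z)"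

end

theory Submission
  imports Defs "HOL-Complex_Analysis.Cauchy_Integral_Formula"
begin

text \<open>
  The functions \<open>f\<^sub>k(z) = z\<^sub>i |z|\<^sup>2\<^sup>k\<close> concentrate near the sphere: their norms tend to 0 while their
  radial derivatives stay large. By circle invariance of the measure and Cauchy's formula on the
  slices \<open>\<lambda> \<mapsto> h(\<lambda>z)\<close>, a function of weight 0 under \<open>z \<mapsto> uz\<close> projects to its mean, and \<open>f\<^sub>k\<close>
  projects to \<open>c\<^sub>k z\<^sub>i\<close> with \<open>c\<^sub>k \<longrightarrow> 0\<close>. Hence the commutator maps \<open>f\<^sub>k\<close> to the constant
  \<open>c\<^sub>k - m\<^sub>k\<close>, where \<open>m\<^sub>k\<close> is the mean of \<open>|z|\<^sup>2\<^sup>k + k |z\<^sub>i|\<^sup>2 |z|\<^sup>2\<^sup>k\<^sup>-\<^sup>2\<close>, and \<open>m\<^sub>k\<close> is bounded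
  below by a positive constant.
\<close>

text \<open>The factor \<open>z $ i\<close> gives the test functions weight 1 under the circle
  action. Differentiation in \<open>z $ i\<close> lowers this to weight 0, the only weight that
  pairs with constants, and the derivative is a nonnegative function, so no cancellation can occur
  in its mean. Differentiating brings down a factor k, while the mass that |z|^(2k) keeps near the
  sphere is of order 1/k; this balance keeps the mean of the derivative away from 0 although the
  function itself becomes small in norm. The obstacle is that the projection is given by
  orthogonality to all holomorphic \<open>h\<close>. Each projection is therefore guessed and then
  tested. Averaging over the circle reduces the test to a single homogeneous Taylor part of
  \<open>h\<close> at 0: the value \<open>h 0\<close> for weight 0, the linear part for weight 1.
  The coordinates other than the i-th in the linear part are removed by a reflection. All moments
  are estimated, not evaluated: everything is compared with the mean of |z|^(2k), which tends to 0,
  and with the mean of |z_i|^2, which is positive.\<close>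

section \<open>Lebesgue measure and normalized measure on the ball\<close>

text \<open>
  The uniqueness argument for Haar measure: for the unit ball \<open>B\<close>, Fubini gives
  \<open>\<nu>(A) \<lambda>(B) = \<lambda>(A) \<nu>(B)\<close> with \<open>\<nu>\<close> the image measure, and \<open>\<nu>(B) = \<lambda>(B)\<close>.
\<close>

lemma lborel_distr_isometry:
  fixes L :: "'a::euclidean_space \<Rightarrow> 'a"
  assumes lin: "linear L" and norm: "\<And>x. norm (L x) = norm x"
  shows "distr lborel borel L = lborel"
proof -
  have L_meas [measurable]: "L \<in> borel_measurable borel"
    using lin by (intro borel_measurable_continuous_onI linear_continuous_on linear_conv_bounded_linear[THEN iffD1])
  have "inj L"
    using lin norm by (metis linear_injective_0 norm_eq_zero)
  hence "surj L" using lin linear_inj_imp_surj by blast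
  have shift: "(\<integral>\<^sup>+x. f (c + x) \<partial>lborel) = (\<integral>\<^sup>+x. f x \<partial>lborel)"
    if [measurable]: "f \<in> borel_measurable borel" for f :: "'a \<Rightarrow> ennreal" and c
    by (subst (2) lborel_distr_plus[symmetric, of c]) (simp add: nn_integral_distr)
  have refl: "(\<integral>\<^sup>+x. f (c - x) \<partial>lborel) = (\<integral>\<^sup>+x. f x \<partial>lborel)"
    if [measurable]: "f \<in> borel_measurable borel" for f :: "'a \<Rightarrow> ennreal" and c
  proof -
    have "distr lborel borel (\<lambda>x. c - x) = lborel"
      using lborel_affine[of "-1" c] by (simp add: density_1)
    hence "(\<integral>\<^sup>+x. f x \<partial>lborel) = (\<integral>\<^sup>+x. f x \<partial>distr lborel borel (\<lambda>x. c - x))" by simp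
    thus ?thesis by (simp add: nn_integral_distr)
  qed
  define B where "B = ball (0::'a) 1"
  have [measurable]: "B \<in> sets borel" by (simp add: B_def)
  have B_inv: "L x \<in> B \<longleftrightarrow> x \<in> B" for x by (simp add: B_def norm)
  have "emeasure lborel A = emeasure (distr lborel borel L) A" if [measurable]: "A \<in> sets borel" for A
  proof -
    have "emeasure (distr lborel borel L) A * emeasure lborel B
        = (\<integral>\<^sup>+x. indicator A (L x) * emeasure lborel B \<partial>lborel)"
      by (simp add: nn_integral_multc nn_integral_distr flip: nn_integral_indicator)
    also have "\<dots> = (\<integral>\<^sup>+x. (\<integral>\<^sup>+y. indicator A (L x) * indicator B (L x + y) \<partial>lborel) \<partial>lborel)"
      by (rule nn_integral_cong) (subst nn_integral_cmult, simp, simp add: shift)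
    also have "\<dots> = (\<integral>\<^sup>+y. (\<integral>\<^sup>+x. indicator A (L x) * indicator B (L x + y) \<partial>lborel) \<partial>lborel)"
      by (subst lborel_pair.Fubini') simp_all
    also have "\<dots> = (\<integral>\<^sup>+y. (\<integral>\<^sup>+x. indicator A (L x - y) * indicator B (L x) \<partial>lborel) \<partial>lborel)"
    proof (rule nn_integral_cong)
      fix y :: "'a"
      \<comment> \<open>Translating \<open>x\<close> by a preimage of \<open>-y\<close> moves the
        shift by \<open>y\<close> from the argument of \<open>B\<close> to that of
        \<open>A\<close>.\<close>
      obtain c where c: "L c = -y" using \<open>surj L\<close> by (metis surj_def)
      have "(\<integral>\<^sup>+x. indicator A (L x) * indicator B (L x + y) \<partial>lborel)
          = (\<integral>\<^sup>+x. indicator A (L (c + x)) * (indicator B (L (c + x) + y) :: ennreal) \<partial>lborel)"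
        by (subst shift[of "\<lambda>x. indicator A (L x) * indicator B (L x + y)"]) simp_all
      thus "(\<integral>\<^sup>+x. indicator A (L x) * indicator B (L x + y) \<partial>lborel) =
           (\<integral>\<^sup>+x. indicator A (L x - y) * (indicator B (L x) :: ennreal) \<partial>lborel)"
        by (simp add: linear_add[OF lin] c)
    qed
    also have "\<dots> = (\<integral>\<^sup>+x. (\<integral>\<^sup>+y. indicator A (L x - y) * indicator B (L x) \<partial>lborel) \<partial>lborel)"
      by (subst lborel_pair.Fubini') simp_all
    \<comment> \<open>In the inner integral \<open>y\<close> runs through the reflection
      \<open>y \<mapsto> L x - y\<close>, which preserves Lebesgue measure; the isometry then
      disappears from the factor for \<open>B\<close>.\<close>
    also have "\<dots> = (\<integral>\<^sup>+x. emeasure lborel A * indicator B x \<partial>lborel)"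
      by (rule nn_integral_cong, subst nn_integral_multc)
         (simp_all add: refl B_inv indicator_def[of B])
    also have "\<dots> = emeasure lborel A * emeasure lborel B"
      by (simp add: nn_integral_cmult)
    finally have eq: "emeasure (distr lborel borel L) A * emeasure lborel B = emeasure lborel A * emeasure lborel B" .
    have "emeasure lborel B \<noteq> 0" "emeasure lborel B \<noteq> top"
      using content_ball_pos[of 1 "0::'a"] emeasure_lborel_ball_finite[of "0::'a" 1]
      by (auto simp: B_def measure_def less_top)
    thus ?thesis using eq by (metis ennreal_mult_cancel_left mult.commute)
  qed
  thus ?thesis by (intro measure_eqI) auto
qed

section \<open>Normalized measure on the ball: completed and Borel versions\<close>

text \<open>The uncompleted counterpart of \<open>ball_measure\<close>. Image measures under linear
  maps and product measurability for Fubini are handled on Borel sets; integrals of Borel functions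
  agree for the two measures, so results transfer back.\<close>

definition ball_borel :: "(complex ^ 'n) measure" where
  "ball_borel = uniform_measure lborel unit_ball"

lemma sets_ball_borel [simp, measurable_cong]: "sets ball_borel = sets borel"
  by (simp add: ball_borel_def)

lemma space_ball_borel [simp]: "space ball_borel = UNIV"
  by (simp add: ball_borel_def)

lemma sets_ball_measure [simp, measurable_cong]: "sets ball_measure = sets lebesgue"
  by (simp add: ball_measure_def)

lemma space_ball_measure [simp]: "space ball_measure = UNIV"
  by (simp add: ball_measure_def)

lemma emeasure_unit_ball_nonzero: "emeasure lborel (unit_ball :: (complex ^ 'n) set) \<noteq> 0"
  using content_ball_pos[of 1 "0::complex ^ 'n"] by (auto simp: measure_def)

lemma emeasure_unit_ball_finite: "emeasure lborel (unit_ball :: (complex ^ 'n) set) \<noteq> \<infinity>"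
  using emeasure_lborel_ball_finite[of "0::complex ^ 'n" 1] by (auto simp: less_top)

lemma finite_measure_ball_borel: "finite_measure (ball_borel :: (complex ^ 'n) measure)"
  unfolding ball_borel_def using emeasure_unit_ball_nonzero[where 'n='n] emeasure_unit_ball_finite[where 'n='n]
  by (auto intro!: finite_measureI simp: less_top)

lemma finite_measure_ball_measure: "finite_measure (ball_measure :: (complex ^ 'n) measure)"
  unfolding ball_measure_def using emeasure_unit_ball_nonzero[where 'n='n] emeasure_unit_ball_finite[where 'n='n]
  by (auto intro!: finite_measureI simp: less_top)

lemma integrable_const_ball_borel [simp]:
  fixes c :: "'b::{banach, second_countable_topology}"
  shows "integrable ball_borel (\<lambda>_ :: complex ^ 'n. c)"
  by (rule finite_measure.integrable_const[OF finite_measure_ball_borel])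

lemma measure_ball_borel: "measure ball_borel (UNIV :: (complex ^ 'n) set) = 1"
  unfolding ball_borel_def using emeasure_unit_ball_nonzero[where 'n='n] emeasure_unit_ball_finite[where 'n='n]
  by (auto simp: measure_def less_top)

lemma measure_ball_measure: "measure ball_measure (UNIV :: (complex ^ 'n) set) = 1"
  unfolding ball_measure_def using emeasure_unit_ball_nonzero[where 'n='n] emeasure_unit_ball_finite[where 'n='n]
  by (auto simp: measure_def less_top)

lemma emeasure_ball_measure:
  "A \<in> sets borel \<Longrightarrow> emeasure ball_measure A = emeasure ball_borel A"
  by (simp add: ball_borel_def ball_measure_def)

lemma integral_ball_measure:
  fixes g :: "complex ^ 'n \<Rightarrow> 'b::{banach, second_countable_topology}"
  assumes "g \<in> borel_measurable borel"
  shows "integral\<^sup>L ball_measure g = integral\<^sup>L ball_borel g"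
  by (rule integral_subalgebra[symmetric]) (use assms in \<open>auto simp: emeasure_ball_measure\<close>)

lemma integrable_ball_measure:
  fixes g :: "complex ^ 'n \<Rightarrow> 'b::{banach, second_countable_topology}"
  assumes "g \<in> borel_measurable borel"
  shows "integrable ball_measure g \<longleftrightarrow> integrable ball_borel g"
  by (rule integrable_subalgebra[symmetric]) (use assms in \<open>auto simp: emeasure_ball_measure\<close>)

lemma AE_ball_measure: "AE z in ball_measure. z \<in> unit_ball"
  unfolding ball_measure_def by (intro AE_uniform_measureI) auto

lemma AE_ball_borel: "AE z in ball_borel. z \<in> unit_ball"
  unfolding ball_borel_def by (intro AE_uniform_measureI) auto

lemma borel_measurable_ball_measure:
  "g \<in> borel_measurable borel \<Longrightarrow> g \<in> borel_measurable ball_measure"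
  by (simp add: measurable_completion measurable_lborel1 cong: measurable_cong_sets)

lemma distr_ball_borel:
  fixes L :: "complex ^ 'n \<Rightarrow> complex ^ 'n"
  assumes lin: "linear L" and norm: "\<And>x. norm (L x) = norm x"
  shows "distr ball_borel borel L = ball_borel"
proof (rule measure_eqI)
  have [measurable]: "L \<in> borel_measurable borel"
    using lin by (intro borel_measurable_continuous_onI linear_continuous_on linear_conv_bounded_linear[THEN iffD1])
  fix A assume "A \<in> sets (distr ball_borel borel L)"
  hence [measurable]: "A \<in> sets borel" by simp
  have "emeasure lborel (unit_ball \<inter> L -` A) = emeasure lborel (L -` (unit_ball \<inter> A))"
    by (rule arg_cong[where f="emeasure lborel"]) (auto simp: norm)
  also have "\<dots> = emeasure (distr lborel borel L) (unit_ball \<inter> A)"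
    by (simp add: emeasure_distr)
  also have "\<dots> = emeasure lborel (unit_ball \<inter> A)"
    by (simp add: lborel_distr_isometry[OF assms])
  finally show "emeasure (distr ball_borel borel L) A = emeasure ball_borel A"
    using measurable_sets_borel[of L borel A] by (simp add: emeasure_distr ball_borel_def)
qed simp

lemma integral_ball_borel_isometry:
  fixes L :: "complex ^ 'n \<Rightarrow> complex ^ 'n"
    and g :: "complex ^ 'n \<Rightarrow> 'b::{banach, second_countable_topology}"
  assumes lin: "linear L" and norm: "\<And>x. norm (L x) = norm x"
    and [measurable]: "g \<in> borel_measurable borel"
  shows "(LINT z|ball_borel. g (L z)) = integral\<^sup>L ball_borel g"
proof -
  have [measurable]: "L \<in> borel_measurable borel"
    using lin by (intro borel_measurable_continuous_onI linear_continuous_on linear_conv_bounded_linear[THEN iffD1])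
  show ?thesis
    by (subst (2) distr_ball_borel[OF lin norm, symmetric]) (simp add: integral_distr)
qed

lemma integrable_ball_borel_isometry:
  fixes L :: "complex ^ 'n \<Rightarrow> complex ^ 'n"
    and g :: "complex ^ 'n \<Rightarrow> 'b::{banach, second_countable_topology}"
  assumes lin: "linear L" and norm: "\<And>x. norm (L x) = norm x"
    and [measurable]: "g \<in> borel_measurable borel"
  shows "integrable ball_borel (\<lambda>z. g (L z)) \<longleftrightarrow> integrable ball_borel g"
proof -
  have [measurable]: "L \<in> borel_measurable borel"
    using lin by (intro borel_measurable_continuous_onI linear_continuous_on linear_conv_bounded_linear[THEN iffD1])
  show ?thesis
    by (subst (2) distr_ball_borel[OF lin norm, symmetric]) (simp add: integrable_distr_eq)
qed

section \<open>Square-integrable functions and the Bergman projection\<close>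

lemma L2_bounded:
  assumes [measurable]: "f \<in> borel_measurable borel" and bound: "\<And>z. z \<in> unit_ball \<Longrightarrow> cmod (f z) \<le> K"
  shows "f \<in> L2"
proof -
  have "f \<in> borel_measurable ball_measure"
    by (rule borel_measurable_ball_measure) fact
  moreover have "AE z in ball_measure. norm ((cmod (f z))\<^sup>2) \<le> K\<^sup>2"
    using AE_ball_measure by eventually_elim (simp add: bound power_mono)
  ultimately show ?thesis
    unfolding L2_def by (auto intro!: finite_measure.integrable_const_bound[OF finite_measure_ball_measure])
qed

lemma borel_measurable_cnj [measurable]:
  "g \<in> borel_measurable M \<Longrightarrow> (\<lambda>x. cnj (g x)) \<in> borel_measurable M"
  by (rule borel_measurable_continuous_on[OF continuous_on_cnj[OF continuous_on_id]])

lemma L2_iff: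
  "f \<in> L2 \<longleftrightarrow> f \<in> borel_measurable ball_measure \<and> integrable ball_measure (\<lambda>z. (cmod (f z))\<^sup>2)"
  by (simp add: L2_def)

lemma L2_mult_integrable:
  assumes "f \<in> L2" "g \<in> L2"
  shows "integrable ball_measure (\<lambda>z. f z * cnj (g z))"
proof (rule Bochner_Integration.integrable_bound)
  have [measurable]: "f \<in> borel_measurable ball_measure" "g \<in> borel_measurable ball_measure"
    using assms by (simp_all only: L2_iff)
  show "integrable ball_measure (\<lambda>z. (cmod (f z))\<^sup>2 + (cmod (g z))\<^sup>2)"
    using assms unfolding L2_iff by (intro Bochner_Integration.integrable_add) blast+
  show "(\<lambda>z. f z * cnj (g z)) \<in> borel_measurable ball_measure" by measurable
  have "cmod (f z) * cmod (g z) \<le> (cmod (f z))\<^sup>2 + (cmod (g z))\<^sup>2" for z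
    using sum_squares_bound[of "cmod (f z)" "cmod (g z)"] mult_nonneg_nonneg[OF norm_ge_zero norm_ge_zero, of "f z" "g z"]
    by linarith
  thus "AE z in ball_measure. norm (f z * cnj (g z)) \<le> norm ((cmod (f z))\<^sup>2 + (cmod (g z))\<^sup>2)"
    by (auto simp: norm_mult)
qed

lemma L2_diff:
  assumes "f \<in> L2" "g \<in> L2"
  shows "(\<lambda>z. f z - g z) \<in> L2"
proof -
  have [measurable]: "f \<in> borel_measurable ball_measure" "g \<in> borel_measurable ball_measure"
    using assms by (simp_all only: L2_iff)
  have "integrable ball_measure (\<lambda>z. (cmod (f z - g z))\<^sup>2)"
  proof (rule Bochner_Integration.integrable_bound)
    show "integrable ball_measure (\<lambda>z. 2 * (cmod (f z))\<^sup>2 + 2 * (cmod (g z))\<^sup>2)"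
      using assms unfolding L2_iff
      by (intro Bochner_Integration.integrable_add integrable_mult_right) blast+
    show "(\<lambda>z. (cmod (f z - g z))\<^sup>2) \<in> borel_measurable ball_measure" by measurable
    have "(cmod (f z - g z))\<^sup>2 \<le> 2 * (cmod (f z))\<^sup>2 + 2 * (cmod (g z))\<^sup>2" for z
    proof -
      have "(cmod (f z - g z))\<^sup>2 \<le> (cmod (f z) + cmod (g z))\<^sup>2"
        by (intro power_mono norm_triangle_ineq4) auto
      thus ?thesis
        using sum_squares_bound[of "cmod (f z)" "cmod (g z)"] by (simp add: power2_sum)
    qed
    thus "AE z in ball_measure. norm ((cmod (f z - g z))\<^sup>2) \<le> norm (2 * (cmod (f z))\<^sup>2 + 2 * (cmod (g z))\<^sup>2)"
      by auto
  qed
  moreover have "(\<lambda>z. f z - g z) \<in> borel_measurable ball_measure" by measurable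
  ultimately show ?thesis unfolding L2_iff by blast
qed

lemma L2_inner_diff_left:
  assumes "f \<in> L2" "g \<in> L2" "h \<in> L2"
  shows "L2_inner (\<lambda>z. f z - g z) h = L2_inner f h - L2_inner g h"
  using L2_mult_integrable[OF assms(1,3)] L2_mult_integrable[OF assms(2,3)]
  by (simp add: L2_inner_def left_diff_distrib)

lemma holomorphic_on_ball_diff:
  fixes f g :: "complex ^ 'n \<Rightarrow> complex"
  assumes "holomorphic_on_ball f" "holomorphic_on_ball g"
  shows "holomorphic_on_ball (\<lambda>z. f z - g z)"
  unfolding holomorphic_on_ball_def
proof
  fix z :: "complex ^ 'n" assume z: "z \<in> unit_ball"
  obtain f' where f': "(f has_derivative f') (at z)" "\<And>c v. f' (c *s v) = c * f' v"
    using assms(1) z unfolding holomorphic_on_ball_def by blast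
  obtain g' where g': "(g has_derivative g') (at z)" "\<And>c v. g' (c *s v) = c * g' v"
    using assms(2) z unfolding holomorphic_on_ball_def by blast
  show "\<exists>d. ((\<lambda>z. f z - g z) has_derivative d) (at z) \<and> (\<forall>c v. d (c *s v) = c * d v)"
    using has_derivative_diff[OF f'(1) g'(1)] f'(2) g'(2)
    by (intro exI[of _ "\<lambda>v. f' v - g' v"]) (auto simp: right_diff_distrib)
qed

lemma holomorphic_on_ball_continuous:
  "holomorphic_on_ball f \<Longrightarrow> continuous_on unit_ball f"
  unfolding holomorphic_on_ball_def
  by (meson continuous_at_imp_continuous_on has_derivative_continuous)

text \<open>The nonvanishing set of \<open>f\<close> in the ball is open, and an open negligible set
  is empty. This upgrades equality of classes to pointwise equality, as the definite description in
  \<open>bergman_projection\<close> demands.\<close>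

lemma AE_zero_imp_zero_on_ball:
  assumes cont: "continuous_on unit_ball f" and ae: "AE z in ball_measure. f z = 0"
    and z: "z \<in> unit_ball"
  shows "f z = (0::complex)"
proof -
  have "AE z in lebesgue. z \<in> unit_ball \<longrightarrow> f z = 0"
    using ae emeasure_unit_ball_nonzero emeasure_unit_ball_finite unfolding ball_measure_def
    by (subst (asm) AE_uniform_measure) (auto simp: less_top)
  hence "AE z in lborel. z \<in> unit_ball \<longrightarrow> f z = 0"
    by (simp add: AE_completion_iff)
  hence "AE z in lborel. z \<notin> unit_ball \<inter> f -` (-{0})"
    by eventually_elim auto
  moreover have op: "open (unit_ball \<inter> f -` (-{0}))"
    using cont by (intro continuous_open_preimage) auto
  ultimately have "unit_ball \<inter> f -` (-{0}) \<in> null_sets lborel"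
    by (subst AE_iff_null_sets) auto
  hence "negligible (unit_ball \<inter> f -` (-{0}))"
    by (simp add: negligible_iff_null_sets null_sets_completionI)
  with op have "unit_ball \<inter> f -` (-{0}) = {}"
    using open_not_negligible by blast
  with z show ?thesis by auto
qed

text \<open>Reduces the computation of a projection to guessing it. For a second candidate
  \<open>k\<close>, the difference \<open>d\<close> of the candidates lies in the Bergman space and
  is itself admissible as \<open>h\<close>; subtracting the two orthogonality relations leaves
  \<open>L2_inner d d = 0\<close>.\<close>

lemma bergman_projection_eqI:
  assumes f: "f \<in> L2" and g: "g \<in> bergman_space"
    and orth: "\<And>h. h \<in> bergman_space \<Longrightarrow> L2_inner (\<lambda>z. f z - g z) h = 0"
    and off: "\<And>z. z \<notin> unit_ball \<Longrightarrow> g z = 0"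
  shows "bergman_projection f = g"
  unfolding bergman_projection_def
proof (rule the_equality)
  show "g \<in> bergman_space \<and> (\<forall>h\<in>bergman_space. L2_inner (\<lambda>z. f z - g z) h = 0) \<and>
        (\<forall>z. z \<notin> unit_ball \<longrightarrow> g z = 0)"
    using assms by auto
next
  fix k
  assume k: "k \<in> bergman_space \<and> (\<forall>h\<in>bergman_space. L2_inner (\<lambda>z. f z - k z) h = 0) \<and>
        (\<forall>z. z \<notin> unit_ball \<longrightarrow> k z = 0)"
  define d where "d = (\<lambda>z. k z - g z)"
  have L2: "g \<in> L2" "k \<in> L2" using g k by (auto simp: bergman_space_def)
  have d: "d \<in> bergman_space" "d \<in> L2" "holomorphic_on_ball d"
    using g k by (auto simp: bergman_space_def d_def L2_diff holomorphic_on_ball_diff)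
  have "L2_inner f d - L2_inner g d = 0" "L2_inner f d - L2_inner k d = 0"
    using orth[OF d(1)] k d L2 f by (auto simp: L2_inner_diff_left)
  hence "L2_inner d d = 0"
    using d L2 by (subst (1) d_def) (simp add: L2_inner_diff_left)
  moreover have "L2_inner d d = of_real (LINT z|ball_measure. (cmod (d z))\<^sup>2)"
    unfolding L2_inner_def by (subst integral_complex_of_real[symmetric]) (simp only: complex_norm_square)
  ultimately have "(LINT z|ball_measure. (cmod (d z))\<^sup>2) = 0" by simp
  hence "AE z in ball_measure. (cmod (d z))\<^sup>2 = 0"
    using d(2) by (subst (asm) integral_nonneg_eq_0_iff_AE) (auto simp: L2_def)
  hence "AE z in ball_measure. d z = 0" by simp
  hence "d z = 0" if "z \<in> unit_ball" for z
    using AE_zero_imp_zero_on_ball[OF holomorphic_on_ball_continuous] d that by blast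
  thus "k = g"
    using k off by (intro ext) (metis d_def eq_iff_diff_eq_0)
qed

section \<open>Averaging over the circle action\<close>

lemma norm_vector_scalar_mult: "norm (c *s z) = cmod c * norm (z :: complex ^ 'n)"
proof -
  have "(\<Sum>i\<in>UNIV. (cmod (c * z $ i))\<^sup>2) = (cmod c)\<^sup>2 * (\<Sum>i\<in>UNIV. (cmod (z $ i))\<^sup>2)"
    by (simp add: norm_mult power_mult_distrib sum_distrib_left)
  thus ?thesis
    by (simp add: norm_vec_def L2_set_def real_sqrt_mult)
qed

lemma bounded_linear_scalar_mult_left: "bounded_linear (\<lambda>c. c *s (z :: complex ^ 'n))"
  by (intro bounded_linear_intro[where K = "norm z"])
     (auto simp: vec_eq_iff norm_vector_scalar_mult algebra_simps)

lemma linear_scalar_mult: "linear (\<lambda>z :: complex ^ 'n. c *s z)"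
  by (intro linearI) (auto simp: vec_eq_iff algebra_simps)

text \<open>Complex homogeneity of \<open>h'\<close> is what turns the real derivative along the
  slice into multiplication by the complex number \<open>h' z\<close>.\<close>

lemma slice_has_field_derivative:
  fixes h :: "complex ^ 'n \<Rightarrow> complex"
  assumes "(h has_derivative h') (at (l *s z))" "\<And>c v. h' (c *s v) = c * h' v"
  shows "((\<lambda>l. h (l *s z)) has_field_derivative h' z) (at l)"
proof -
  have "((\<lambda>l. l *s z) has_derivative (\<lambda>c. c *s z)) (at l)"
    by (intro bounded_linear_imp_has_derivative bounded_linear_scalar_mult_left)
  from has_derivative_compose[OF this assms(1)]
  have "((\<lambda>l. h (l *s z)) has_derivative (\<lambda>c. h' (c *s z))) (at l)" .
  moreover have "(\<lambda>c. h' (c *s z)) = (*) (h' z)"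
    by (rule ext) (simp add: assms(2))
  ultimately show ?thesis
    by (simp only: has_field_derivative_def)
qed

text \<open>Cauchy's formula on the unit circle: the mean extracts the m-th Taylor coefficient of
  the slice. One power of the kernel \<open>u ^ Suc m\<close> is absorbed by du = 2 pi i u
  dt.\<close>

lemma circle_mean_slice:
  assumes hol: "holomorphic_on_ball h" and z: "z \<in> unit_ball"
  shows "(LINT t|lborel. indicator {0..1} t *\<^sub>R (h (exp (2 * of_real pi * \<i> * of_real t) *s z) / exp (2 * of_real pi * \<i> * of_real t) ^ m))
         = (deriv ^^ m) (\<lambda>l. h (l *s z)) 0 / fact m"
proof -
  define F where "F = (\<lambda>l. h (l *s z))"
  define U where "U = (\<lambda>t::real. exp (2 * of_real pi * \<i> * of_real t) :: complex)"
  \<comment> \<open>Since \<open>z\<close> lies in the open ball, so does \<open>l *s z\<close> for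
    every \<open>l\<close> in the closed disc. Hence radius 1 is allowed, whatever \<open>h\<close>
    does at the sphere.\<close>
  have diff: "F field_differentiable at l" if "cmod l \<le> 1" for l
  proof -
    have "cmod l * norm z \<le> 1 * norm z" using that by (intro mult_right_mono) auto
    hence "l *s z \<in> unit_ball" using z by (simp add: norm_vector_scalar_mult)
    then obtain h' where "(h has_derivative h') (at (l *s z))" "\<And>c v. h' (c *s v) = c * h' v"
      using hol unfolding holomorphic_on_ball_def by blast
    thus ?thesis unfolding F_def field_differentiable_def using slice_has_field_derivative by blast
  qed
  have "((\<lambda>u. F u / (u - 0) ^ Suc m) has_contour_integral (of_real (2 * pi) * \<i> / fact m * (deriv ^^ m) F 0)) (circlepath 0 1)"
  proof (rule Cauchy_has_contour_integral_higher_derivative_circlepath)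
    show "continuous_on (cball 0 1) F"
      using diff by (intro continuous_at_imp_continuous_on) (auto intro: field_differentiable_imp_continuous_at)
    show "F holomorphic_on ball 0 1"
      using diff by (auto simp: holomorphic_on_def intro: field_differentiable_at_within)
  qed simp
  hence "((\<lambda>t. F (U t) / U t ^ Suc m * (of_real (2 * pi) * \<i> * U t)) has_integral (of_real (2 * pi) * \<i> / fact m * (deriv ^^ m) F 0)) {0..1}"
    unfolding has_contour_integral vector_derivative_circlepath by (simp add: circlepath U_def mult_ac)
  hence "((\<lambda>t. F (U t) / U t ^ Suc m * (of_real (2 * pi) * \<i> * U t) / (of_real (2 * pi) * \<i>)) has_integral (of_real (2 * pi) * \<i> / fact m * (deriv ^^ m) F 0) / (of_real (2 * pi) * \<i>)) {0..1}"
    by (rule has_integral_divide)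
  moreover have "F (U t) / U t ^ Suc m * (of_real (2 * pi) * \<i> * U t) / (of_real (2 * pi) * \<i>) = F (U t) / U t ^ m" for t
    by (simp add: U_def)
  ultimately have I: "((\<lambda>t. F (U t) / U t ^ m) has_integral ((deriv ^^ m) F 0 / fact m)) {0..1}"
    by simp
  have "continuous_on {0..1} (\<lambda>t. F (U t) / U t ^ m)"
  proof -
    have "continuous_on {0..1} U" unfolding U_def by (intro continuous_intros)
    moreover have "continuous_on (cball 0 1) F"
      using diff by (intro continuous_at_imp_continuous_on) (auto intro: field_differentiable_imp_continuous_at)
    moreover have "U ` {0..1} \<subseteq> cball 0 1" by (auto simp: U_def)
    ultimately have "continuous_on {0..1} (\<lambda>t. F (U t))" "continuous_on {0..1} (\<lambda>t. U t ^ m)"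
      by (blast intro: continuous_on_compose2 continuous_on_power)+
    thus ?thesis by (rule continuous_on_divide) (simp add: U_def)
  qed
  hence "set_integrable lborel {0..1} (\<lambda>t. F (U t) / U t ^ m)"
    unfolding set_integrable_def by (intro borel_integrable_compact) auto
  hence "(LINT t:{0..1}|lborel. F (U t) / U t ^ m) = integral {0..1} (\<lambda>t. F (U t) / U t ^ m)"
    by (rule set_borel_integral_eq_integral(2))
  also have "\<dots> = (deriv ^^ m) F 0 / fact m" using I by (rule integral_unique)
  finally show ?thesis by (simp add: set_lebesgue_integral_def F_def U_def)
qed

text \<open>
  The indicator makes the right-hand integrand vanish where slices of \<open>h\<close> may fail to be holomorphic,
  so that it is measurable as a parameter integral.
\<close>

lemma L2_inner_circle_mean:
  fixes \<psi> h :: "complex ^ 'n \<Rightarrow> complex"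
  assumes [measurable]: "\<psi> \<in> borel_measurable borel"
    and bound: "\<And>z. z \<in> unit_ball \<Longrightarrow> cmod (\<psi> z) \<le> K"
    and weight: "\<And>u z. cmod u = 1 \<Longrightarrow> \<psi> (u *s z) = u ^ m * \<psi> z"
    and h: "h \<in> bergman_space"
  shows "L2_inner \<psi> h =
      (LINT z|ball_borel. indicator unit_ball z *\<^sub>R (\<psi> z * cnj ((deriv ^^ m) (\<lambda>l. h (l *s z)) 0 / fact m)))"
proof -
  have pair: "pair_sigma_finite (lborel :: real measure) (ball_borel :: (complex ^ 'n) measure)"
    by (intro pair_sigma_finite.intro sigma_finite_lborel finite_measure.axioms(1) finite_measure_ball_borel)
  define U where "U = (\<lambda>t::real. exp (2 * of_real pi * \<i> * of_real t) :: complex)"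
  \<comment> \<open>Off the ball \<open>h\<close> is only known to be Lebesgue measurable; the
    cut-off is Borel because \<open>h\<close> is continuous on the open ball.\<close>
  define h0 where "h0 = (\<lambda>z. indicator unit_ball z *\<^sub>R h z)"
  have hol: "holomorphic_on_ball h" and hL2: "h \<in> L2" using h by (auto simp: bergman_space_def)
  have [measurable]: "h0 \<in> borel_measurable borel"
    unfolding h0_def by (intro borel_measurable_continuous_on_indicator holomorphic_on_ball_continuous[OF hol]) auto
  have normU: "cmod (U t) = 1" for t by (simp add: U_def)
  have contU: "continuous_on UNIV U" unfolding U_def by (intro continuous_intros)
  hence [measurable]: "U \<in> borel_measurable borel" by (rule borel_measurable_continuous_onI)
  have "continuous_on UNIV (\<lambda>p. U (fst p) *s (snd p :: complex ^ 'n))"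
    unfolding vector_scalar_mult_def
    by (intro continuous_on_vec_lambda continuous_intros continuous_on_compose2[OF contU]) auto
  hence [measurable]: "(\<lambda>p. U (fst p) *s (snd p :: complex ^ 'n)) \<in> borel \<Otimes>\<^sub>M borel \<rightarrow>\<^sub>M borel"
    unfolding borel_prod by (rule borel_measurable_continuous_onI)
  define G where "G = (\<lambda>z. \<psi> z * cnj (h0 z))"
  have [measurable]: "G \<in> borel_measurable borel" unfolding G_def by measurable
  have G_ball: "AE z in ball_measure. \<psi> z * cnj (h z) = G z"
    using AE_ball_measure by eventually_elim (simp add: G_def h0_def)
  have "\<psi> \<in> L2" using bound by (intro L2_bounded) auto
  note int = L2_mult_integrable[OF this hL2]
  have G_meas: "G \<in> borel_measurable ball_measure"
    by (rule borel_measurable_ball_measure) measurable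
  have "integrable ball_measure G"
    by (rule integrable_cong_AE_imp[OF int G_meas]) (use G_ball in eventually_elim, simp)
  hence Gint: "integrable ball_borel G" by (simp add: integrable_ball_measure)
  have "L2_inner \<psi> h = integral\<^sup>L ball_measure G"
    unfolding L2_inner_def by (rule integral_cong_AE[OF borel_measurable_integrable[OF int] G_meas G_ball])
  hence inner: "L2_inner \<psi> h = integral\<^sup>L ball_borel G"
    by (simp only: integral_ball_measure[OF \<open>G \<in> borel_measurable borel\<close>])
  \<comment> \<open>Rotation changes the integral for no fixed \<open>t\<close>, so averaging over
    \<open>t\<close> leaves it unchanged; the version with \<open>cmod\<close> supplies the
    integrability for Fubini.\<close>
  have rot: "(LINT z|ball_borel. G (U t *s z)) = integral\<^sup>L ball_borel G"
    "integrable ball_borel (\<lambda>z. G (U t *s z))"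
    "(LINT z|ball_borel. cmod (G (U t *s z))) = (LINT z|ball_borel. cmod (G z))" for t
    using Gint integral_ball_borel_isometry[OF linear_scalar_mult, of "U t" G]
      integrable_ball_borel_isometry[OF linear_scalar_mult, of "U t" G]
      integral_ball_borel_isometry[OF linear_scalar_mult, of "U t" "\<lambda>z. cmod (G z)"]
    by (simp_all add: norm_vector_scalar_mult normU)
  define E where "E = (\<lambda>t z. indicator {0..1} t *\<^sub>R G (U t *s z))"
  have [measurable]: "case_prod E \<in> borel_measurable (borel \<Otimes>\<^sub>M borel)"
    unfolding E_def split_beta by measurable
  have slice: "(LINT t|lborel. E t z) = indicator unit_ball z *\<^sub>R (\<psi> z * cnj ((deriv ^^ m) (\<lambda>l. h (l *s z)) 0 / fact m))" for z
  proof (cases "z \<in> unit_ball")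
    case True
    have "E t z = \<psi> z * cnj (indicator {0..1} t *\<^sub>R (h (U t *s z) / U t ^ m))" for t
    proof -
      \<comment> \<open>On the unit circle \<open>u ^ m\<close> is the conjugate of
        \<open>1 / u ^ m\<close>. The weight of \<psi> thus moves under the conjugation, where it
        selects the m-th Taylor coefficient of \<open>h\<close>.\<close>
      have "cnj (U t) * U t = 1"
        using complex_norm_square[of "U t"] by (simp add: normU mult.commute)
      hence "cnj (U t) ^ m * U t ^ m = 1" by (simp flip: power_mult_distrib)
      hence "U t ^ m = cnj (1 / U t ^ m)"
        by (metis complex_cnj_divide complex_cnj_one complex_cnj_power mult_zero_left nonzero_mult_div_cancel_left zero_neq_one)
      hence "G (U t *s z) = \<psi> z * cnj (h (U t *s z) / U t ^ m)"
        using True by (simp add: G_def h0_def weight normU norm_vector_scalar_mult)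
      thus ?thesis by (simp add: E_def)
    qed
    hence "(LINT t|lborel. E t z) = \<psi> z * cnj (LINT t|lborel. indicator {0..1} t *\<^sub>R (h (U t *s z) / U t ^ m))"
      by (simp only: integral_mult_right_zero Bochner_Integration.integral_cnj)
    thus ?thesis using circle_mean_slice[OF hol True, of m] True by (simp add: U_def)
  next
    case False
    thus ?thesis by (simp add: E_def G_def h0_def norm_vector_scalar_mult normU)
  qed
  have "integrable (lborel \<Otimes>\<^sub>M ball_borel) (case_prod E)"
  proof (rule pair_sigma_finite.Fubini_integrable[OF pair])
    show "integrable lborel (\<lambda>t. LINT z|ball_borel. norm (case_prod E (t, z)))"
      by (simp add: E_def rot)
    show "AE t in lborel. integrable ball_borel (\<lambda>z. case_prod E (t, z))"
      by (simp add: E_def rot)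
  qed (auto cong: measurable_cong_sets)
  hence "(LINT t|lborel. LINT z|ball_borel. E t z) = (LINT z|ball_borel. LINT t|lborel. E t z)"
    by (rule pair_sigma_finite.Fubini_integral[OF pair, symmetric])
  also have "\<dots> = (LINT z|ball_borel. indicator unit_ball z *\<^sub>R (\<psi> z * cnj ((deriv ^^ m) (\<lambda>l. h (l *s z)) 0 / fact m)))"
    by (simp only: slice)
  finally have "(LINT t|lborel. LINT z|ball_borel. E t z) = \<dots>" .
  moreover have "(LINT t|lborel. LINT z|ball_borel. E t z) = integral\<^sup>L ball_borel G"
    by (simp add: E_def rot)
  ultimately show ?thesis by (simp add: inner)
qed

section \<open>Projections of circle-invariant functions and of radial multiples of a
  coordinate\<close>

lemma integrable_ball_bounded:
  fixes g :: "complex ^ 'n \<Rightarrow> 'b::{banach, second_countable_topology}"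
  assumes "g \<in> borel_measurable borel" and bound: "\<And>z. z \<in> unit_ball \<Longrightarrow> norm (g z) \<le> K"
  shows "integrable ball_borel g"
proof -
  have "AE z in ball_borel. norm (g z) \<le> K"
    using AE_ball_borel by eventually_elim (simp add: bound)
  thus ?thesis using assms(1) by (intro finite_measure.integrable_const_bound[OF finite_measure_ball_borel]) auto
qed

lemma integral_indicator_ball:
  fixes g :: "complex ^ 'n \<Rightarrow> 'b::{banach, second_countable_topology}"
  assumes [measurable]: "g \<in> borel_measurable borel"
  shows "(LINT z|ball_borel. indicator unit_ball z *\<^sub>R g z) = integral\<^sup>L ball_borel g"
proof (rule integral_cong_AE)
  have [measurable]: "unit_ball \<in> sets (borel :: (complex ^ 'n) measure)" by simp
  show "(\<lambda>z. indicator unit_ball z *\<^sub>R g z) \<in> borel_measurable ball_borel" by measurable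
  show "AE z in ball_borel. indicator unit_ball z *\<^sub>R g z = g z"
    using AE_ball_borel by eventually_elim simp
qed simp

lemma borel_measurable_component [measurable]:
  "(\<lambda>z :: complex ^ 'n. z $ i) \<in> borel_measurable borel"
  by (intro borel_measurable_continuous_onI continuous_intros)

lemma component_le_1: "z \<in> unit_ball \<Longrightarrow> cmod (z $ i) \<le> 1"
  using Finite_Cartesian_Product.norm_nth_le[of z i] by simp

lemma component_sq_le_1: "z \<in> unit_ball \<Longrightarrow> (cmod (z $ i))\<^sup>2 \<le> 1"
  using component_le_1[of z i] by (intro power_le_one) auto

text \<open>Weight 0 pairs with \<open>h\<close> only through \<open>h 0\<close>, so subtracting the
  mean makes \<open>g\<close> orthogonal to every \<open>h\<close>.\<close>

lemma bergman_projection_circle_invariant: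
  fixes g :: "complex ^ 'n \<Rightarrow> complex"
  assumes [measurable]: "g \<in> borel_measurable borel"
    and bound: "\<And>z. z \<in> unit_ball \<Longrightarrow> cmod (g z) \<le> K"
    and inv: "\<And>u z. cmod u = 1 \<Longrightarrow> g (u *s z) = g z"
  shows "bergman_projection g = (\<lambda>z. indicator unit_ball z *\<^sub>R integral\<^sup>L ball_borel g)"
    (is "_ = ?P")
proof (rule bergman_projection_eqI)
  have [measurable]: "unit_ball \<in> sets (borel :: (complex ^ 'n) measure)" by simp
  define c where "c = integral\<^sup>L ball_borel g"
  show "g \<in> L2" using bound by (intro L2_bounded) auto
  have "?P \<in> L2" by (rule L2_bounded[where K="cmod c"]) (auto simp: c_def)
  moreover have "holomorphic_on_ball ?P"
    unfolding holomorphic_on_ball_def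
  proof
    fix z :: "complex ^ 'n" assume z: "z \<in> unit_ball"
    have "(?P has_derivative (\<lambda>_. 0)) (at z)"
      by (rule has_derivative_transform_within_open[OF has_derivative_const open_ball z]) (simp add: c_def)
    thus "\<exists>f'. (?P has_derivative f') (at z) \<and> (\<forall>c v. f' (c *s v) = c * f' v)"
      by (intro exI conjI allI, assumption) simp
  qed
  ultimately show "?P \<in> bergman_space" by (simp add: bergman_space_def)
  fix h :: "complex ^ 'n \<Rightarrow> complex" assume h: "h \<in> bergman_space"
  define \<psi> where "\<psi> = (\<lambda>z. g z - indicator unit_ball z *\<^sub>R c)"
  have [measurable]: "\<psi> \<in> borel_measurable borel" unfolding \<psi>_def by measurable
  have bnd: "cmod (\<psi> z) \<le> K + cmod c" if "z \<in> unit_ball" for z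
    using norm_triangle_ineq4[of "g z" c] bound[OF that] that by (simp add: \<psi>_def)
  have "L2_inner \<psi> h = (LINT z|ball_borel. indicator unit_ball z *\<^sub>R (\<psi> z * cnj ((deriv ^^ 0) (\<lambda>l. h (l *s z)) 0 / fact 0)))"
  proof (rule L2_inner_circle_mean[OF _ bnd _ h])
    show "\<psi> (u *s z) = u ^ 0 * \<psi> z" if "cmod u = 1" for u z
      using that inv by (simp add: \<psi>_def norm_vector_scalar_mult indicator_def)
  qed simp
  also have "\<dots> = integral\<^sup>L ball_borel \<psi> * cnj (h 0)"
    by (simp add: integral_indicator_ball)
  also have "integral\<^sup>L ball_borel \<psi> = 0"
  proof -
    have "(LINT z::complex^'n|ball_borel. indicator unit_ball z *\<^sub>R c) = c"
      by (subst integral_indicator_ball) (simp_all add: measure_ball_borel)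
    moreover have "integrable ball_borel g" "integrable ball_borel (\<lambda>z::complex^'n. indicator unit_ball z *\<^sub>R c)"
      by (rule integrable_ball_bounded[where K=K] integrable_ball_bounded[where K="cmod c"]; use bound in simp)+
    ultimately show ?thesis
      by (simp add: \<psi>_def c_def)
  qed
  finally show "L2_inner (\<lambda>z. g z - ?P z) h = 0" by (simp add: \<psi>_def c_def)
qed simp

lemma borel_measurable_norm_power [measurable]:
  "(\<lambda>z :: complex ^ 'n. norm z ^ k) \<in> borel_measurable borel"
  by (intro borel_measurable_continuous_onI continuous_intros)

lemma integrable_component_norm_power:
  "integrable ball_borel (\<lambda>z :: complex ^ 'n. (cmod (z $ i))\<^sup>2 * norm z ^ k)"
proof (rule integrable_ball_bounded[where K=1])
  fix z :: "complex ^ 'n" assume z: "z \<in> unit_ball"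
  have "(cmod (z $ i))\<^sup>2 * norm z ^ k \<le> 1 * 1"
    using component_le_1[OF z, of i] z by (intro mult_mono power_le_one) auto
  thus "norm ((cmod (z $ i))\<^sup>2 * norm z ^ k) \<le> 1" by (simp add: abs_mult)
qed simp

lemma integrable_component_sq:
  "integrable ball_borel (\<lambda>z :: complex ^ 'n. (cmod (z $ i))\<^sup>2)"
  using integrable_component_norm_power[of i 0] by simp

text \<open>Otherwise the coordinate would vanish on the whole ball by continuity, which fails at
  \<open>axis i (1/2)\<close>. The integral is the squared norm of the coordinate function and
  serves as a denominator below.\<close>

lemma integral_component_sq_pos:
  "(LINT z :: complex ^ 'n|ball_borel. (cmod (z $ i))\<^sup>2) > 0"
proof -
  have "(LINT z :: complex ^ 'n|ball_borel. (cmod (z $ i))\<^sup>2) \<noteq> 0"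
  proof
    assume "(LINT z :: complex ^ 'n|ball_borel. (cmod (z $ i))\<^sup>2) = 0"
    hence "(LINT z :: complex ^ 'n|ball_measure. (cmod (z $ i))\<^sup>2) = 0"
      by (simp add: integral_ball_measure)
    moreover have "integrable ball_measure (\<lambda>z :: complex ^ 'n. (cmod (z $ i))\<^sup>2)"
      using integrable_component_sq[of i] by (simp add: integrable_ball_measure)
    ultimately have "AE z :: complex ^ 'n in ball_measure. z $ i = 0"
      by (subst (asm) integral_nonneg_eq_0_iff_AE) auto
    from AE_zero_imp_zero_on_ball[OF _ this, of "axis i (1/2)"] show False
      by (simp add: continuous_on_component norm_vec_def L2_set_def axis_def if_distrib[of cmod] if_distrib[of "\<lambda>x. x\<^sup>2"] cong: if_cong)
  qed
  moreover have "(LINT z :: complex ^ 'n|ball_borel. (cmod (z $ i))\<^sup>2) \<ge> 0" by simp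
  ultimately show ?thesis by linarith
qed

text \<open>Weight 1 pairs with \<open>h\<close> only through its complex-linear derivative
  \<open>h'\<close> at 0. The components of \<open>h'\<close> other than the i-th contribute nothing
  by symmetry, and \<open>c\<close>, the inner product of the function with the i-th coordinate
  divided by the squared norm of that coordinate, removes the i-th.\<close>

lemma bergman_projection_radial_component:
  fixes \<rho> :: "complex ^ 'n \<Rightarrow> real"
  assumes [measurable]: "\<rho> \<in> borel_measurable borel"
    and bound: "\<And>z. z \<in> unit_ball \<Longrightarrow> \<bar>\<rho> z\<bar> \<le> K"
    and radial: "\<And>z w. norm z = norm w \<Longrightarrow> \<rho> z = \<rho> w"
  obtains c :: real where
    "bergman_projection (\<lambda>z. z $ i * of_real (\<rho> z)) = (\<lambda>z. indicator unit_ball z *\<^sub>R (c * z $ i))"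
    "c * (LINT z :: complex ^ 'n|ball_borel. (cmod (z $ i))\<^sup>2) = (LINT z|ball_borel. (cmod (z $ i))\<^sup>2 * \<rho> z)"
proof
  let ?c = "(LINT z|ball_borel. (cmod (z $ i))\<^sup>2 * \<rho> z) / (LINT z :: complex ^ 'n|ball_borel. (cmod (z $ i))\<^sup>2)"
  show c: "?c * (LINT z :: complex ^ 'n|ball_borel. (cmod (z $ i))\<^sup>2) = (LINT z|ball_borel. (cmod (z $ i))\<^sup>2 * \<rho> z)"
    using integral_component_sq_pos[of i] by simp
  define c where "c = ?c"
  let ?f = "\<lambda>z. z $ i * of_real (\<rho> z)" and ?P = "\<lambda>z. indicator unit_ball z *\<^sub>R (c * z $ i)"
  have "bergman_projection ?f = ?P"
  proof (rule bergman_projection_eqI)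
    have [measurable]: "unit_ball \<in> sets (borel :: (complex ^ 'n) measure)" by simp
    have "cmod (?f z) \<le> K" if "z \<in> unit_ball" for z
      using mult_mono[OF component_le_1[OF that] bound[OF that]] by (simp add: norm_mult)
    thus "?f \<in> L2" by (intro L2_bounded) auto
    have "cmod (?P z) \<le> \<bar>c\<bar>" for z
      using component_le_1[of z i] mult_left_mono[of "cmod (z $ i)" 1 "\<bar>c\<bar>"]
      by (cases "z \<in> unit_ball") (auto simp: norm_mult)
    hence "?P \<in> L2" by (intro L2_bounded) (measurable, blast)
    moreover have "holomorphic_on_ball ?P"
      unfolding holomorphic_on_ball_def
    proof
      fix z :: "complex ^ 'n" assume z: "z \<in> unit_ball"
      have "bounded_linear (\<lambda>z :: complex ^ 'n. of_real c * z $ i)"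
        by (intro bounded_linear_const_mult bounded_linear_vec_nth)
      hence "((\<lambda>z. of_real c * z $ i) has_derivative (\<lambda>z. of_real c * z $ i)) (at z)"
        by (rule bounded_linear_imp_has_derivative)
      hence "(?P has_derivative (\<lambda>z. of_real c * z $ i)) (at z)"
        by (rule has_derivative_transform_within_open[OF _ open_ball z]) simp
      thus "\<exists>f'. (?P has_derivative f') (at z) \<and> (\<forall>c v. f' (c *s v) = c * f' v)"
        by (intro exI conjI allI, assumption) simp
    qed
    ultimately show "?P \<in> bergman_space" by (simp add: bergman_space_def)
    fix h :: "complex ^ 'n \<Rightarrow> complex" assume h: "h \<in> bergman_space"
    hence "holomorphic_on_ball h" by (simp add: bergman_space_def)
    then obtain h' where h': "(h has_derivative h') (at 0)" "\<And>c v. h' (c *s v) = c * h' v"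
      unfolding holomorphic_on_ball_def using centre_in_ball[of "0 :: complex ^ 'n" 1] zero_less_one by blast
    have bl: "bounded_linear h'" using h' by (rule_tac has_derivative_bounded_linear)
    have [measurable]: "h' \<in> borel_measurable borel"
      using bl by (intro borel_measurable_continuous_onI linear_continuous_on)
    define \<psi> where "\<psi> = (\<lambda>z :: complex ^ 'n. z $ i * of_real (\<rho> z - indicator unit_ball z * c))"
    have [measurable]: "\<psi> \<in> borel_measurable borel" unfolding \<psi>_def by measurable
    have bnd: "cmod (\<psi> z) \<le> K + \<bar>c\<bar>" if "z \<in> unit_ball" for z
    proof -
      have "cmod (z $ i) * \<bar>\<rho> z - c\<bar> \<le> 1 * (K + \<bar>c\<bar>)"
        using component_le_1[OF that, of i] bound[OF that] by (intro mult_mono) auto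
      thus ?thesis using that by (simp add: \<psi>_def norm_mult flip: of_real_diff)
    qed
    have "(deriv ^^ 1) (\<lambda>l. h (l *s z)) 0 = h' z" for z
      using slice_has_field_derivative[of h h' 0 z] h' by (simp add: DERIV_imp_deriv)
    moreover have "L2_inner \<psi> h = (LINT z|ball_borel. indicator unit_ball z *\<^sub>R (\<psi> z * cnj ((deriv ^^ 1) (\<lambda>l. h (l *s z)) 0 / fact 1)))"
    proof (rule L2_inner_circle_mean[OF _ bnd _ h])
      show "\<psi> (u *s z) = u ^ 1 * \<psi> z" if "cmod u = 1" for u z
        using that radial[of "u *s z" z] by (simp add: \<psi>_def norm_vector_scalar_mult indicator_def)
    qed simp
    ultimately have inner: "L2_inner \<psi> h = (LINT z|ball_borel. \<psi> z * cnj (h' z))"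
      by (simp add: integral_indicator_ball)
    \<comment> \<open>The reflection in the \<open>i\<close>-th coordinate removes all terms of \<open>h'\<close> but the \<open>i\<close>-th.\<close>
    define R where "R = (\<lambda>z :: complex ^ 'n. \<chi> j. if j = i then - z $ j else z $ j)"
    have linR: "linear R" by (intro linearI) (auto simp: R_def vec_eq_iff)
    have "norm (R z) = norm z" for z
      unfolding norm_vec_def L2_set_def R_def by (intro arg_cong[where f=sqrt] sum.cong) auto
    note R = linR this
    \<comment> \<open>\<open>z\<close> and its reflection differ by \<open>2 * z $ i\<close> along
      the i-th axis, so complex homogeneity isolates the i-th coefficient of
      \<open>h'\<close>.\<close>
    have h'R: "h' z = h' (R z) + 2 * z $ i * h' (axis i 1)" for z
    proof -
      have "z = R z + (2 * z $ i) *s axis i 1"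
        by (auto simp: R_def vec_eq_iff axis_def)
      hence "h' z = h' (R z + (2 * z $ i) *s axis i 1)" by simp
      also have "\<dots> = h' (R z) + h' ((2 * z $ i) *s axis i 1)"
        by (intro linear_add bounded_linear.linear bl)
      finally show ?thesis by (simp only: h'(2))
    qed
    obtain B where B: "\<And>z. cmod (h' z) \<le> norm z * B" "B > 0" using bounded_linear.pos_bounded[OF bl] by blast
    define H where "H = (\<lambda>z. \<psi> z * cnj (h' z))"
    have [measurable]: "H \<in> borel_measurable borel" unfolding H_def by measurable
    have intH: "integrable ball_borel H"
    proof (rule integrable_ball_bounded)
      fix z :: "complex ^ 'n" assume z: "z \<in> unit_ball"
      have "norm z * B \<le> 1 * B" using z B(2) by (intro mult_right_mono) auto
      hence "cmod (h' z) \<le> B" using B(1)[of z] by linarith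
      thus "norm (H z) \<le> (K + \<bar>c\<bar>) * B"
        unfolding H_def norm_mult using bnd[OF z] by (intro mult_mono) (auto intro: order_trans[OF norm_ge_zero])
    qed simp
    define S where "S = (\<lambda>z :: complex ^ 'n. (cmod (z $ i))\<^sup>2 * (\<rho> z - indicator unit_ball z * c))"
    have \<psi>R: "\<psi> (R z) = - \<psi> z" for z
      using radial[of "R z" z] R(2)[of z] by (simp add: \<psi>_def indicator_def) (simp add: R_def)
    have \<psi>S: "\<psi> z * cnj (z $ i) = of_real (S z)" for z
    proof -
      have "\<psi> z * cnj (z $ i) = (z $ i * cnj (z $ i)) * of_real (\<rho> z - indicator unit_ball z * c)"
        by (simp only: \<psi>_def mult_ac)
      thus ?thesis by (simp only: S_def complex_norm_square of_real_mult)
    qed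
    have HR: "H z = 2 * cnj (h' (axis i 1)) * of_real (S z) - H (R z)" for z
    proof -
      have "H z = \<psi> z * cnj (h' (R z)) + 2 * cnj (h' (axis i 1)) * (\<psi> z * cnj (z $ i))"
        by (simp add: H_def h'R[of z] algebra_simps)
      moreover have "H (R z) = - (\<psi> z * cnj (h' (R z)))"
        by (simp add: H_def \<psi>R)
      ultimately show ?thesis by (simp add: \<psi>S)
    qed
    have intS: "integrable ball_borel S" and S0: "integral\<^sup>L ball_borel S = 0"
    proof -
      have i1: "integrable ball_borel (\<lambda>z. (cmod (z $ i))\<^sup>2 * \<rho> z)"
      proof (rule integrable_ball_bounded)
        show "norm ((cmod (z $ i))\<^sup>2 * \<rho> z) \<le> 1 * K" if "z \<in> unit_ball" for z
          using component_sq_le_1[OF that, of i] bound[OF that] unfolding norm_mult by (intro mult_mono) auto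
      qed simp
      have i2: "integrable ball_borel (\<lambda>z::complex ^ 'n. indicator unit_ball z *\<^sub>R (cmod (z $ i))\<^sup>2)"
        by (rule integrable_ball_bounded[where K=1]) (use component_sq_le_1[of _ i] in simp_all)
      have S_eq: "S = (\<lambda>z. (cmod (z $ i))\<^sup>2 * \<rho> z - c * (indicator unit_ball z *\<^sub>R (cmod (z $ i))\<^sup>2))"
        by (auto simp: S_def algebra_simps)
      show "integrable ball_borel S" unfolding S_eq using i1 i2 by simp
      have "integral\<^sup>L ball_borel S = (LINT z|ball_borel. (cmod (z $ i))\<^sup>2 * \<rho> z)
          - c * (LINT z::complex^'n|ball_borel. indicator unit_ball z *\<^sub>R (cmod (z $ i))\<^sup>2)"
        unfolding S_eq
        by (simp only: Bochner_Integration.integral_diff[OF i1 integrable_mult_right[OF i2]] integral_mult_right_zero)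
      also have "\<dots> = 0"
        by (subst integral_indicator_ball) (simp_all add: c[folded c_def])
      finally show "integral\<^sup>L ball_borel S = 0" .
    qed
    \<comment> \<open>By \<open>HR\<close>, the sum of \<open>H\<close> and its reflection is a
      constant multiple of \<open>S\<close>, which has mean zero by the choice of \<open>c\<close>.
      Isometry invariance makes the two means equal as well, so both vanish.\<close>
    have "integral\<^sup>L ball_borel H = - (LINT z|ball_borel. H (R z))"
    proof -
      have "integrable ball_borel (\<lambda>z. H (R z))"
        using integrable_ball_borel_isometry[OF R, of H] intH by simp
      hence "integral\<^sup>L ball_borel (\<lambda>z. 2 * cnj (h' (axis i 1)) * of_real (S z) - H (R z)) = - (LINT z|ball_borel. H (R z))"
        using intS S0 by (subst Bochner_Integration.integral_diff) auto
      thus ?thesis by (simp flip: HR)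
    qed
    also have "\<dots> = - integral\<^sup>L ball_borel H"
      using integral_ball_borel_isometry[OF R, of H] by simp
    finally have "integral\<^sup>L ball_borel H = 0" by (simp add: eq_neg_iff_add_eq_0)
    hence "L2_inner \<psi> h = 0" by (simp add: inner H_def)
    moreover have "(\<lambda>z. ?f z - ?P z) = \<psi>"
      by (auto simp: \<psi>_def algebra_simps scaleR_conv_of_real fun_eq_iff)
    ultimately show "L2_inner (\<lambda>z. ?f z - ?P z) h = 0" by simp
  qed simp
  thus "bergman_projection ?f = (\<lambda>z. indicator unit_ball z *\<^sub>R (?c * z $ i))"
    by (simp only: c_def)
qed

section \<open>The test functions\<close>

lemma polynomials_component: "(\<lambda>z :: complex ^ 'n. z $ i) \<in> polynomials"
proof -
  have "(\<Prod>j\<in>UNIV. (z $ j) ^ (if j = i then 1 else 0) * cnj (z $ j) ^ 0) = z $ i" for z :: "complex ^ 'n"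
    by (subst prod.remove[of _ i]) (auto intro!: prod.neutral)
  hence "(\<lambda>z::complex^'n. z $ i) = (\<lambda>z. \<Sum>(\<alpha>, \<beta>)\<in>{((\<lambda>j. if j = i then 1 else 0), \<lambda>_. 0)}.
            1 * (\<Prod>j\<in>UNIV. (z $ j) ^ \<alpha> j * (cnj (z $ j)) ^ \<beta> j))"
    by simp
  thus ?thesis unfolding polynomials_def
    by (intro CollectI exI[of _ "{((\<lambda>j. if j = i then 1 else 0), \<lambda>_. 0)}"] exI[of _ "\<lambda>_ _. 1"] conjI) auto
qed

lemma polynomials_add:
  fixes f g :: "complex ^ 'n \<Rightarrow> complex"
  assumes "f \<in> polynomials" "g \<in> polynomials"
  shows "(\<lambda>z. f z + g z) \<in> polynomials"
proof -
  define M where "M = (\<lambda>(z :: complex ^ 'n) \<alpha> \<beta>. \<Prod>j\<in>UNIV. (z $ j) ^ \<alpha> j * (cnj (z $ j)) ^ \<beta> j)"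
  obtain F c where F: "finite F" "f = (\<lambda>z. \<Sum>(\<alpha>, \<beta>)\<in>F. c \<alpha> \<beta> * M z \<alpha> \<beta>)"
    using assms(1) unfolding polynomials_def M_def by blast
  obtain G d where G: "finite G" "g = (\<lambda>z. \<Sum>(\<alpha>, \<beta>)\<in>G. d \<alpha> \<beta> * M z \<alpha> \<beta>)"
    using assms(2) unfolding polynomials_def M_def by blast
  \<comment> \<open>Coefficients outside their own index set are arbitrary, so they are masked
    before being added over the union.\<close>
  define e where "e = (\<lambda>\<alpha> \<beta>. (if (\<alpha>, \<beta>) \<in> F then c \<alpha> \<beta> else 0) + (if (\<alpha>, \<beta>) \<in> G then d \<alpha> \<beta> else 0))"
  have "f z + g z = (\<Sum>(\<alpha>, \<beta>)\<in>F \<union> G. e \<alpha> \<beta> * M z \<alpha> \<beta>)" for z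
  proof -
    have "f z = (\<Sum>p\<in>F \<union> G. (if p \<in> F then c (fst p) (snd p) * M z (fst p) (snd p) else 0))"
      using F G by (subst sum.inter_restrict[symmetric]) (auto simp: split_beta Int_absorb1)
    moreover have "g z = (\<Sum>p\<in>F \<union> G. (if p \<in> G then d (fst p) (snd p) * M z (fst p) (snd p) else 0))"
      using F G by (subst sum.inter_restrict[symmetric]) (auto simp: split_beta Int_absorb1)
    ultimately show ?thesis
      by (simp add: split_beta e_def flip: sum.distrib) (auto intro!: sum.cong simp: algebra_simps)
  qed
  thus ?thesis using F(1) G(1) unfolding polynomials_def M_def
    by (intro CollectI exI[of _ "F \<union> G"] exI[of _ e] conjI) (auto simp: fun_eq_iff)
qed

text \<open>Provides the factor |z|^2 one summand at a time: each summand acts on monomials as a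
  shift of both exponents at \<open>i\<close>.\<close>

lemma polynomials_mult_norm_component:
  fixes f :: "complex ^ 'n \<Rightarrow> complex"
  assumes "f \<in> polynomials"
  shows "(\<lambda>z. z $ i * cnj (z $ i) * f z) \<in> polynomials"
proof -
  define M where "M = (\<lambda>(z :: complex ^ 'n) \<alpha> \<beta>. \<Prod>j\<in>UNIV. (z $ j) ^ \<alpha> j * (cnj (z $ j)) ^ \<beta> j)"
  obtain F c where F: "finite F" "f = (\<lambda>z. \<Sum>(\<alpha>, \<beta>)\<in>F. c \<alpha> \<beta> * M z \<alpha> \<beta>)"
    using assms(1) unfolding polynomials_def M_def by blast
  define s where "s = (\<lambda>(\<alpha> :: 'n \<Rightarrow> nat, \<beta> :: 'n \<Rightarrow> nat). (\<alpha>(i := Suc (\<alpha> i)), \<beta>(i := Suc (\<beta> i))))"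
  \<comment> \<open>Only evaluated on the image of \<open>s\<close>, where both exponents at
    \<open>i\<close> are positive and truncated subtraction undoes the shift.\<close>
  define d where "d = (\<lambda>\<alpha> \<beta>. c (\<alpha>(i := \<alpha> i - 1)) (\<beta>(i := \<beta> i - 1)))"
  have inj: "inj_on s F" unfolding s_def inj_on_def
    by (auto simp: fun_eq_iff) (metis nat.inject)+
  have M: "M z (\<alpha>(i := Suc (\<alpha> i))) (\<beta>(i := Suc (\<beta> i))) = z $ i * cnj (z $ i) * M z \<alpha> \<beta>" for z \<alpha> \<beta>
    unfolding M_def by (subst (1 2) prod.remove[of _ i]) (auto intro!: prod.cong)
  have "z $ i * cnj (z $ i) * f z = (\<Sum>(\<alpha>, \<beta>)\<in>s ` F. d \<alpha> \<beta> * M z \<alpha> \<beta>)" for z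
    unfolding F(2) sum_distrib_left sum.reindex[OF inj]
    by (intro sum.cong) (auto simp: s_def M d_def)
  thus ?thesis using F(1) unfolding polynomials_def M_def
    by (intro CollectI exI[of _ "s ` F"] exI[of _ d] conjI) (auto simp: fun_eq_iff)
qed

lemma polynomials_sum:
  assumes "finite A" "A \<noteq> {}" "\<And>j. j \<in> A \<Longrightarrow> f j \<in> polynomials"
  shows "(\<lambda>z. \<Sum>j\<in>A. f j z) \<in> polynomials"
  using assms by (induction A rule: finite_ne_induct) (auto intro!: polynomials_add)

lemma norm_power2_eq_sum: "complex_of_real ((norm z)\<^sup>2) = (\<Sum>j\<in>UNIV. z $ j * cnj (z $ j))" for z :: "complex ^ 'n"
proof -
  have "(norm z)\<^sup>2 = (\<Sum>j\<in>UNIV. (cmod (z $ j))\<^sup>2)"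
    by (simp add: norm_vec_def L2_set_def sum_nonneg)
  thus ?thesis by (simp only: of_real_sum complex_norm_square)
qed

lemma polynomials_component_norm_power:
  "(\<lambda>z :: complex ^ 'n. z $ i * of_real (norm z ^ (2 * k))) \<in> polynomials"
proof (induction k)
  case 0
  thus ?case using polynomials_component[of i] by simp
next
  case (Suc k)
  have "z $ i * of_real (norm z ^ (2 * Suc k)) = of_real ((norm z)\<^sup>2) * (z $ i * of_real (norm z ^ (2 * k)))" for z :: "complex ^ 'n"
    by (simp add: power2_eq_square algebra_simps)
  hence "(\<lambda>z :: complex ^ 'n. z $ i * of_real (norm z ^ (2 * Suc k)))
      = (\<lambda>z. \<Sum>j\<in>UNIV. z $ j * cnj (z $ j) * (z $ i * of_real (norm z ^ (2 * k))))"
    by (simp only: norm_power2_eq_sum sum_distrib_right)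
  moreover have "\<dots> \<in> polynomials"
    by (intro polynomials_sum polynomials_mult_norm_component Suc) auto
  ultimately show ?case by (simp only:)
qed

section \<open>Wirtinger derivatives of the test functions\<close>

text \<open>The directions \<open>c = 1\<close> and \<open>c = \<i>\<close> give the two real
  partial derivatives in \<open>wirtinger\<close>. For \<open>k = 0\<close> the truncated exponent
  \<open>k - 1\<close> is harmless because of the factor \<open>real k\<close>.\<close>

lemma directional_derivative_component_norm_power:
  fixes z :: "complex ^ 'n"
  shows "((\<lambda>t. (z + t *\<^sub>R axis i c) $ i * of_real (norm (z + t *\<^sub>R axis i c) ^ (2 * k))) has_vector_derivative
     c * of_real (norm z ^ (2 * k)) + z $ i * of_real (2 * real k * norm z ^ (2 * (k - 1)) * (z $ i \<bullet> c))) (at 0)"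
proof -
  \<comment> \<open>The squared norm along the line is a quadratic polynomial in \<open>t\<close>,
    so its powers are differentiable at every \<open>z\<close>, the origin included.\<close>
  define q where "q = (\<lambda>t::real. (z + t *\<^sub>R axis i c) \<bullet> (z + t *\<^sub>R axis i c))"
  have q: "norm (z + t *\<^sub>R axis i c) ^ (2 * k) = q t ^ k" for t k
    by (simp add: q_def power_mult flip: power2_norm_eq_inner)
  have zi: "(z + t *\<^sub>R axis i c) $ i = z $ i + of_real t * c" for t
    by (simp add: scaleR_conv_of_real[symmetric])
  have ip: "z \<bullet> axis i c = z $ i \<bullet> c" by (simp add: inner_axis)
  have "q = (\<lambda>t. z \<bullet> z + 2 * t * (z $ i \<bullet> c) + t\<^sup>2 * (axis i c \<bullet> axis i c))"
    by (auto simp: q_def inner_add_left inner_add_right ip inner_commute[of "axis i c" z] power2_eq_square algebra_simps)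
  hence "(q has_real_derivative 2 * (z $ i \<bullet> c)) (at 0)"
    by (auto intro!: derivative_eq_intros)
  from DERIV_power[OF this, of k]
  have "((\<lambda>t. q t ^ k) has_vector_derivative real k * (2 * (z $ i \<bullet> c) * q 0 ^ (k - 1))) (at 0)"
    by (simp add: has_real_derivative_iff_has_vector_derivative)
  hence "((\<lambda>t. complex_of_real (q t ^ k)) has_vector_derivative of_real (real k * (2 * (z $ i \<bullet> c) * q 0 ^ (k - 1)))) (at 0)"
    by (rule bounded_linear.has_vector_derivative[OF bounded_linear_of_real])
  moreover have "((\<lambda>t. z $ i + of_real t * c) has_vector_derivative c) (at 0)"
    by (auto intro!: derivative_eq_intros)
  ultimately have "((\<lambda>t. (z $ i + of_real t * c) * of_real (q t ^ k)) has_vector_derivative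
      (z $ i + of_real 0 * c) * of_real (real k * (2 * (z $ i \<bullet> c) * q 0 ^ (k - 1))) + c * of_real (q 0 ^ k)) (at 0)"
    by (intro has_vector_derivative_mult)
  moreover have "q 0 ^ k = norm z ^ (2 * k)" "q 0 ^ (k - 1) = norm z ^ (2 * (k - 1))"
    using q[of 0] by simp_all
  ultimately have "((\<lambda>t. (z $ i + of_real t * c) * of_real (q t ^ k)) has_vector_derivative
      (z $ i + of_real 0 * c) * of_real (real k * (2 * (z $ i \<bullet> c) * norm z ^ (2 * (k - 1)))) + c * of_real (norm z ^ (2 * k))) (at 0)"
    by (simp only:)
  thus ?thesis
    unfolding q zi by (simp add: mult_ac add_ac)
qed

lemma wirtinger_component_norm_power:
  "wirtinger i (\<lambda>z. z $ i * of_real (norm z ^ (2 * k))) z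
     = of_real (norm z ^ (2 * k) + real k * (cmod (z $ i))\<^sup>2 * norm z ^ (2 * (k - 1)))"
proof -
  define p where "p = norm z ^ (2 * (k - 1))"
  define P where "P = norm z ^ (2 * k)"
  have "wirtinger i (\<lambda>z. z $ i * of_real (norm z ^ (2 * k))) z =
     ((1 * of_real P + z $ i * of_real (2 * real k * p * (z $ i \<bullet> 1)))
     - \<i> * (\<i> * of_real P + z $ i * of_real (2 * real k * p * (z $ i \<bullet> \<i>)))) / 2"
    unfolding wirtinger_def p_def P_def
    by (simp only: directional_derivative_component_norm_power[THEN vector_derivative_at])
  \<comment> \<open>The inner products with 1 and \<i> are the real and imaginary parts of
    \<open>z $ i\<close>; they combine to its conjugate.\<close>
  also have "\<dots> = of_real P + of_real (real k * p) * (z $ i * cnj (z $ i))"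
    by (simp add: complex_eq_iff inner_complex_def field_simps)
  also have "\<dots> = of_real (P + real k * (cmod (z $ i))\<^sup>2 * p)"
    by (simp only: complex_norm_square[symmetric]) simp
  finally show ?thesis by (simp add: p_def P_def)
qed

section \<open>Asymptotics of the moments\<close>

text \<open>This one sequence controls both the norms of the test functions and the coefficients of
  their projections.\<close>

lemma integral_norm_power_tendsto_0:
  "(\<lambda>k. LINT z :: complex ^ 'n|ball_borel. norm z ^ (2 * k)) \<longlonglongrightarrow> 0"
proof -
  have "(\<lambda>k. LINT z :: complex ^ 'n|ball_borel. norm z ^ (2 * k)) \<longlonglongrightarrow> (LINT z :: complex ^ 'n|ball_borel. 0)"
  proof (rule integral_dominated_convergence[where w="\<lambda>_. 1"])
    show "AE z :: complex ^ 'n in ball_borel. (\<lambda>k. norm z ^ (2 * k)) \<longlonglongrightarrow> 0"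
      using AE_ball_borel
    proof eventually_elim
      fix z :: "complex ^ 'n" assume "z \<in> unit_ball"
      hence "(norm z)\<^sup>2 < 1" by (simp add: abs_square_less_1)
      hence "(\<lambda>k. ((norm z)\<^sup>2) ^ k) \<longlonglongrightarrow> 0" by (intro LIMSEQ_power_zero) auto
      thus "(\<lambda>k. norm z ^ (2 * k)) \<longlonglongrightarrow> 0" by (simp add: power_mult)
    qed
    show "AE z :: complex ^ 'n in ball_borel. norm (norm z ^ (2 * k)) \<le> 1" for k
      using AE_ball_borel by eventually_elim (auto intro: power_le_one)
  qed auto
  thus ?thesis by simp
qed

text \<open>Substitution by the dilation with factor \<open>r\<close>, whose Jacobian is
  \<open>r\<close> to the real dimension. It plays the part of polar coordinates: for a homogeneous
  integrand the share of the smaller ball becomes explicit.\<close>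

lemma integral_shrunk_ball:
  fixes g :: "complex ^ 'n \<Rightarrow> real"
  assumes r: "0 < r" "r \<le> 1" and [measurable]: "g \<in> borel_measurable borel"
  shows "(LINT z|ball_borel. indicator (ball 0 r) z * g z)
       = r ^ DIM(complex ^ 'n) * (LINT z|ball_borel. g (r *\<^sub>R z))"
proof -
  have density: "ball_borel = density lborel (\<lambda>z::complex^'n. ennreal (indicator unit_ball z / measure lborel (unit_ball :: (complex^'n) set)))"
    unfolding ball_borel_def uniform_measure_def
    using emeasure_unit_ball_finite[where 'n='n] content_ball_pos[of 1 "0::complex^'n"]
    by (intro density_cong) (auto simp: emeasure_eq_ennreal_measure indicator_def simp flip: divide_ennreal ennreal_1)
  have integral: "integral\<^sup>L ball_borel f = (LINT z|lborel. indicator unit_ball z * f z) / measure lborel (unit_ball :: (complex^'n) set)"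
    if [measurable]: "f \<in> borel_measurable borel" for f :: "complex^'n \<Rightarrow> real"
  proof -
    have [measurable]: "(\<lambda>z. indicator unit_ball z / measure lborel (unit_ball :: (complex^'n) set)) \<in> borel_measurable (borel :: (complex^'n) measure)"
      by (intro borel_measurable_divide borel_measurable_indicator borel_measurable_const) auto
    show ?thesis
      unfolding density by (subst integral_density) auto
  qed
  have [measurable]: "ball (0 :: complex ^ 'n) r \<in> sets borel" by simp
  have "(LINT z|lborel. indicator (ball 0 r) z * g z) = r ^ DIM(complex ^ 'n) * (LINT z|lborel. indicator (ball 0 r) (r *\<^sub>R z) * g (r *\<^sub>R z))"
    using r by (subst lborel_affine[of r 0], simp, subst integral_density) (auto simp: integral_distr)
  moreover have "(LINT z|lborel. indicator (ball 0 r) (r *\<^sub>R z) * g (r *\<^sub>R z)) = (LINT z|lborel. indicator unit_ball z * g (r *\<^sub>R z))"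
    using r by (intro Bochner_Integration.integral_cong) (auto simp: indicator_def)
  moreover have "(LINT z|lborel. indicator unit_ball z * (indicator (ball 0 r) z * g z)) = (LINT z|lborel. indicator (ball 0 r) z * g z)"
    using r by (intro Bochner_Integration.integral_cong) (auto simp: indicator_def)
  moreover have "(\<lambda>z. indicator (ball 0 r) z * g z) \<in> borel_measurable borel" "(\<lambda>z. g (r *\<^sub>R z)) \<in> borel_measurable borel"
    by measurable
  ultimately show ?thesis by (simp only: integral) simp
qed

text \<open>
  Integrate only over the shell \<open>r \<le> |z| < 1\<close> with \<open>r = 1 - 1/(4k)\<close>, whose thickness \<open>1/(4k)\<close> compensates
  the factor \<open>k\<close>, while \<open>r\<^sup>2\<^sup>k\<^sup>-\<^sup>2\<close> stays above \<open>1/2\<close>.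
\<close>

lemma integral_component_norm_power_lower:
  fixes i :: "'n::finite"
  assumes k: "k > 0"
  shows "real k * (LINT z :: complex ^ 'n|ball_borel. (cmod (z $ i))\<^sup>2 * norm z ^ (2 * (k - 1)))
     \<ge> (LINT z :: complex ^ 'n|ball_borel. (cmod (z $ i))\<^sup>2) / 8"
proof -
  define M where "M = (LINT z :: complex ^ 'n|ball_borel. (cmod (z $ i))\<^sup>2)"
  define r :: real where "r = 1 - 1 / (4 * k)"
  have "1 / (4 * real k) \<le> 1 / 4" using k by (simp add: field_simps)
  hence r: "0 < r" "r \<le> 1" unfolding r_def by (linarith, simp)
  define d where "d = DIM(complex ^ 'n)"
  have [measurable]: "ball (0 :: complex ^ 'n) r \<in> sets borel" by simp
  have scale: "(cmod ((r *\<^sub>R z) $ i))\<^sup>2 = r\<^sup>2 * (cmod (z $ i))\<^sup>2" for z :: "complex ^ 'n"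
    by (simp add: power_mult_distrib)
  \<comment> \<open>Homogeneity of degree 2 contributes two powers of \<open>r\<close> beyond the
    Jacobian.\<close>
  have "(LINT z :: complex ^ 'n|ball_borel. indicator (ball 0 r) z * (cmod (z $ i))\<^sup>2) = r ^ d * (r\<^sup>2 * M)"
    using r by (subst integral_shrunk_ball) (simp_all only: scale integral_mult_right_zero M_def d_def, measurable)
  hence inner_eq: "(LINT z :: complex ^ 'n|ball_borel. indicator (ball 0 r) z * (cmod (z $ i))\<^sup>2) = r ^ (d + 2) * M"
    by (simp add: power_add power2_eq_square)
  have int: "integrable ball_borel (\<lambda>z :: complex ^ 'n. indicator (ball 0 r) z * (cmod (z $ i))\<^sup>2)"
    using component_sq_le_1[of _ i]
    by (intro integrable_ball_bounded[where K=1]) (auto simp: indicator_def)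
  \<comment> \<open>\<open>M - r ^ (d + 2) * M\<close> is the mass of the shell. On it
    \<open>norm z\<close> is at least \<open>r\<close>; on the inner ball the minorant is 0.\<close>
  have "r ^ (2 * (k - 1)) * (M - r ^ (d + 2) * M)
      = (LINT z :: complex ^ 'n|ball_borel. r ^ (2 * (k - 1)) * ((cmod (z $ i))\<^sup>2 - indicator (ball 0 r) z * (cmod (z $ i))\<^sup>2))"
    using int integrable_component_sq[of i] by (simp add: inner_eq M_def)
  also have "\<dots> \<le> (LINT z :: complex ^ 'n|ball_borel. (cmod (z $ i))\<^sup>2 * norm z ^ (2 * (k - 1)))"
  proof (rule integral_mono)
    fix z :: "complex ^ 'n"
    show "r ^ (2 * (k - 1)) * ((cmod (z $ i))\<^sup>2 - indicator (ball 0 r) z * (cmod (z $ i))\<^sup>2)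
        \<le> (cmod (z $ i))\<^sup>2 * norm z ^ (2 * (k - 1))"
    proof (cases "z \<in> ball 0 r")
      case False
      hence "r ^ (2 * (k - 1)) \<le> norm z ^ (2 * (k - 1))"
        using r by (intro power_mono) auto
      from mult_left_mono[OF this, of "(cmod (z $ i))\<^sup>2"] False show ?thesis
        by (simp add: mult.commute)
    qed simp
  qed (use int integrable_component_sq[of i] integrable_component_norm_power[of i] in auto)
  finally have main: "r ^ (2 * (k - 1)) * (M - r ^ (d + 2) * M)
      \<le> (LINT z :: complex ^ 'n|ball_borel. (cmod (z $ i))\<^sup>2 * norm z ^ (2 * (k - 1)))" .
  have M: "M > 0" unfolding M_def by (rule integral_component_sq_pos)
  \<comment> \<open>Bernoulli's inequality: \<open>2 * (k - 1)\<close> factors lose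
    \<open>1 / (4 * k)\<close> each, hence at most 1/2 in total.\<close>
  have "1 / 2 \<le> 1 + real (2 * (k - 1)) * (- 1 / (4 * k))"
    using k by (simp add: field_simps)
  also have "\<dots> \<le> (1 + (- 1 / (4 * k))) ^ (2 * (k - 1))"
    using k by (intro Bernoulli_inequality) (simp add: field_simps)
  finally have a: "1 / 2 \<le> r ^ (2 * (k - 1))" by (simp add: r_def)
  have "r ^ (d + 2) \<le> r ^ 1" using r by (intro power_decreasing) auto
  hence b: "1 / (4 * real k) \<le> 1 - r ^ (d + 2)" by (simp add: r_def)
  \<comment> \<open>The shell carries at least the fraction \<open>1 - r = 1 / (4 * k)\<close> of
    the mass. The factors 2 and 4 make up the constant 8.\<close>
  have "1 / 2 * (1 / (4 * real k)) \<le> r ^ (2 * (k - 1)) * (1 - r ^ (d + 2))"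
    using a b k by (intro mult_mono) auto
  hence "M * (1 / 2 * (1 / (4 * real k))) \<le> M * (r ^ (2 * (k - 1)) * (1 - r ^ (d + 2)))"
    using M by (intro mult_left_mono) auto
  also have "\<dots> = r ^ (2 * (k - 1)) * (M - r ^ (d + 2) * M)" by (simp add: algebra_simps)
  also note main
  finally have "real k * (M * (1 / 2 * (1 / (4 * real k)))) \<le> real k * (LINT z :: complex ^ 'n|ball_borel. (cmod (z $ i))\<^sup>2 * norm z ^ (2 * (k - 1)))"
    by (intro mult_left_mono) auto
  thus ?thesis using k by (simp add: M_def)
qed

section \<open>The commutator on the test functions and the contradiction\<close>

text \<open>The ball is open, so lines through an interior point stay inside it for small
  \<open>t\<close>, and the cut-off is invisible to the derivative.\<close>

lemma wirtinger_component_on_ball: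
  fixes z :: "complex ^ 'n"
  assumes z: "z \<in> unit_ball"
  shows "wirtinger i (\<lambda>z. indicator unit_ball z *\<^sub>R (c * z $ i)) z = c"
proof -
  have deriv: "((\<lambda>t. indicator unit_ball (z + t *\<^sub>R axis i a) *\<^sub>R (c * (z + t *\<^sub>R axis i a) $ i))
      has_vector_derivative c * a) (at 0)" for a
  proof (rule has_vector_derivative_transform_within_open)
    show "((\<lambda>t. c * z $ i + t *\<^sub>R (c * a)) has_vector_derivative c * a) (at 0)"
      by (auto intro!: derivative_eq_intros)
    show "open ((\<lambda>t. z + t *\<^sub>R axis i a) -` unit_ball)"
      by (intro open_vimage open_ball continuous_intros)
  qed (use z in \<open>auto simp: algebra_simps\<close>)
  show ?thesis
    unfolding wirtinger_def deriv[THEN vector_derivative_at]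
    by (simp add: mult.commute[of c] flip: mult.assoc)
qed

lemma norm_power_le_1: "z \<in> unit_ball \<Longrightarrow> norm z ^ k \<le> 1"
  by (simp add: power_le_one)

text \<open>The derivative lowers the weight of \<open>f\<close> from 1 to 0, so \<open>f\<close>
  and its derivative fall under the two projection formulas. The coefficient \<open>c\<close> is
  kept as the solution of an equation, which suffices to bound it from above.\<close>

lemma commutator_component_norm_power:
  fixes i :: "'n::finite" and k :: nat
  defines "f \<equiv> \<lambda>z :: complex ^ 'n. z $ i * of_real (norm z ^ (2 * k))"
  obtains c :: real where
    "\<And>z. z \<in> unit_ball \<Longrightarrow> commutator (wirtinger i) bergman_projection f z
       = of_real (c - ((LINT z :: complex ^ 'n|ball_borel. norm z ^ (2 * k))
          + real k * (LINT z :: complex ^ 'n|ball_borel. (cmod (z $ i))\<^sup>2 * norm z ^ (2 * (k - 1)))))"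
    "c * (LINT z :: complex ^ 'n|ball_borel. (cmod (z $ i))\<^sup>2)
       = (LINT z :: complex ^ 'n|ball_borel. (cmod (z $ i))\<^sup>2 * norm z ^ (2 * k))"
proof -
  let ?I = "LINT z :: complex ^ 'n|ball_borel. norm z ^ (2 * k)"
  let ?B = "LINT z :: complex ^ 'n|ball_borel. (cmod (z $ i))\<^sup>2 * norm z ^ (2 * (k - 1))"
  have bound: "\<bar>norm z ^ (2 * k)\<bar> \<le> 1" if "z \<in> unit_ball" for z :: "complex ^ 'n"
    using norm_power_le_1[OF that] by simp
  have radial: "norm z ^ (2 * k) = norm w ^ (2 * k)" if "norm z = norm w" for z w :: "complex ^ 'n"
    by (simp only: that)
  obtain c :: real where P: "bergman_projection f = (\<lambda>z. indicator unit_ball z *\<^sub>R (c * z $ i))"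
    and c: "c * (LINT z :: complex ^ 'n|ball_borel. (cmod (z $ i))\<^sup>2)
       = (LINT z :: complex ^ 'n|ball_borel. (cmod (z $ i))\<^sup>2 * norm z ^ (2 * k))"
    unfolding f_def
    by (rule bergman_projection_radial_component[OF borel_measurable_norm_power bound radial])
  define g where "g = (\<lambda>z :: complex ^ 'n. norm z ^ (2 * k) + real k * ((cmod (z $ i))\<^sup>2 * norm z ^ (2 * (k - 1))))"
  have [measurable]: "g \<in> borel_measurable borel" unfolding g_def by measurable
  have "wirtinger i f = (\<lambda>z. of_real (g z))"
    unfolding f_def g_def by (rule ext) (simp only: wirtinger_component_norm_power mult.assoc)
  moreover have "bergman_projection (\<lambda>z. of_real (g z)) = (\<lambda>z. indicator unit_ball z *\<^sub>R (LINT z|ball_borel. of_real (g z)))"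
  proof (rule bergman_projection_circle_invariant[where K="1 + real k * (1 * 1)"])
    fix z :: "complex ^ 'n" assume z: "z \<in> unit_ball"
    have "g z \<le> 1 + real k * (1 * 1)"
      unfolding g_def using component_sq_le_1[OF z, of i] norm_power_le_1[OF z]
      by (intro add_mono mult_left_mono mult_mono) auto
    moreover have "g z \<ge> 0" unfolding g_def by simp
    ultimately show "cmod (of_real (g z)) \<le> 1 + real k * (1 * 1)" by simp
  next
    show "complex_of_real (g (u *s z)) = of_real (g z)" if "cmod u = 1" for u z
      using that by (simp add: g_def norm_vector_scalar_mult norm_mult)
  qed simp
  moreover have "(LINT z|ball_borel. complex_of_real (g z)) = of_real (?I + real k * ?B)"
  proof -
    have "integrable ball_borel (\<lambda>z :: complex ^ 'n. norm z ^ (2 * k))"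
      by (rule integrable_ball_bounded[where K=1]) (simp_all add: norm_power_le_1 power_le_one)
    thus ?thesis
      using integrable_component_norm_power[of i "2 * (k - 1)"]
      by (simp add: g_def del: of_real_add of_real_mult of_real_power)
  qed
  ultimately have Q: "bergman_projection (wirtinger i f) z = of_real (?I + real k * ?B)" if "z \<in> unit_ball" for z
    using that by simp
  show thesis
  proof (rule that[OF _ c])
    fix z :: "complex ^ 'n" assume z: "z \<in> unit_ball"
    show "commutator (wirtinger i) bergman_projection f z = of_real (c - (?I + real k * ?B))"
      unfolding commutator_def P Q[OF z] wirtinger_component_on_ball[OF z] by (simp only: of_real_diff)
  qed
qed

lemma L2_norm_eq_const:
  fixes f :: "complex ^ 'n \<Rightarrow> complex"
  assumes "f \<in> L2" "AE z in ball_measure. f z = c"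
  shows "L2_norm f = cmod c"
proof -
  have "(LINT z|ball_measure. (cmod (f z))\<^sup>2) = (LINT z :: complex ^ 'n|ball_measure. (cmod c)\<^sup>2)"
  proof (rule integral_cong_AE)
    show "(\<lambda>z. (cmod (f z))\<^sup>2) \<in> borel_measurable ball_measure"
      using assms(1) by (auto simp: L2_def)
    show "AE z in ball_measure. (cmod (f z))\<^sup>2 = (cmod c)\<^sup>2"
      using assms(2) by eventually_elim simp
  qed simp
  thus ?thesis by (simp add: L2_norm_def measure_ball_measure)
qed

text \<open>The squared modulus contains |z|^(4k), deliberately weakened to |z|^(2k) so that the
  norm and the projection coefficient are controlled by the same integrals.\<close>

lemma L2_norm_component_norm_power:
  "L2_norm (\<lambda>z :: complex ^ 'n. z $ i * of_real (norm z ^ (2 * k)))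
     \<le> sqrt (LINT z :: complex ^ 'n|ball_borel. norm z ^ (2 * k))"
proof -
  have sq: "(cmod (z $ i * of_real (norm z ^ (2 * k))))\<^sup>2 = (cmod (z $ i))\<^sup>2 * norm z ^ (2 * (2 * k))" for z :: "complex ^ 'n"
    by (simp add: norm_mult power_mult_distrib norm_power flip: power_mult)
  have "(LINT z :: complex ^ 'n|ball_borel. (cmod (z $ i))\<^sup>2 * norm z ^ (2 * (2 * k)))
      \<le> (LINT z :: complex ^ 'n|ball_borel. norm z ^ (2 * k))"
  proof (rule integral_mono_AE)
    show "integrable ball_borel (\<lambda>z :: complex ^ 'n. norm z ^ (2 * k))"
      by (rule integrable_ball_bounded[where K=1]) (simp_all add: norm_power_le_1 power_le_one)
    show "AE z :: complex ^ 'n in ball_borel. (cmod (z $ i))\<^sup>2 * norm z ^ (2 * (2 * k)) \<le> norm z ^ (2 * k)"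
      using AE_ball_borel
    proof eventually_elim
      fix z :: "complex ^ 'n" assume z: "z \<in> unit_ball"
      have "(cmod (z $ i))\<^sup>2 * norm z ^ (2 * (2 * k)) \<le> 1 * norm z ^ (2 * k)"
        using z component_sq_le_1[OF z, of i] by (intro mult_mono power_decreasing) auto
      thus "(cmod (z $ i))\<^sup>2 * norm z ^ (2 * (2 * k)) \<le> norm z ^ (2 * k)" by simp
    qed
  qed (rule integrable_component_norm_power)
  thus ?thesis
    unfolding L2_norm_def sq by (subst integral_ball_measure) simp_all
qed

theorem theorem7p3p1:
  fixes i :: "'n::finite"
  shows "\<not> (\<exists>T :: (complex ^ 'n \<Rightarrow> complex) \<Rightarrow> (complex ^ 'n \<Rightarrow> complex).
            bounded_L2_operator T \<and>
            (\<forall>f\<in>polynomials. AE z in ball_measure.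
               T f z = commutator (wirtinger i) bergman_projection f z))"
proof
  assume "\<exists>T :: (complex ^ 'n \<Rightarrow> complex) \<Rightarrow> (complex ^ 'n \<Rightarrow> complex).
            bounded_L2_operator T \<and>
            (\<forall>f\<in>polynomials. AE z in ball_measure.
               T f z = commutator (wirtinger i) bergman_projection f z)"
  then obtain T :: "(complex ^ 'n \<Rightarrow> complex) \<Rightarrow> (complex ^ 'n \<Rightarrow> complex)"
    where bdd: "bounded_L2_operator T"
      and T: "\<And>f. f \<in> polynomials \<Longrightarrow> AE z in ball_measure. T f z = commutator (wirtinger i) bergman_projection f z"
    by auto
  have T_L2: "T f \<in> L2" if "f \<in> L2" for f
    using bdd that unfolding bounded_L2_operator_def by (elim conjE) blast
  obtain C where C: "L2_norm (T f) \<le> C * L2_norm f" if "f \<in> L2" for f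
    using bdd unfolding bounded_L2_operator_def by (elim conjE) blast
  define f where "f = (\<lambda>k (z :: complex ^ 'n). z $ i * of_real (norm z ^ (2 * k)))"
  define M where "M = (LINT z :: complex ^ 'n|ball_borel. (cmod (z $ i))\<^sup>2)"
  define I where "I = (\<lambda>k. LINT z :: complex ^ 'n|ball_borel. norm z ^ (2 * k))"
  define A where "A = (\<lambda>k. LINT z :: complex ^ 'n|ball_borel. (cmod (z $ i))\<^sup>2 * norm z ^ (2 * k))"
  have M: "M > 0" unfolding M_def by (rule integral_component_sq_pos)
  \<comment> \<open>The constant value \<open>c\<close> of the commutator satisfies
    \<open>real k * A (k - 1) = c' - I k - c\<close>, which is at most
    \<open>c' + \<bar>c\<bar>\<close>. The left side is at least \<open>M / 8\<close>, while
    \<open>c'\<close> and \<open>\<bar>c\<bar>\<close> are bounded by quantities tending to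
    0.\<close>
  have bound: "M / 8 \<le> \<bar>C\<bar> * sqrt (I k) + I k / M" if k: "k > 0" for k
  proof -
    have "f k \<in> L2"
      unfolding f_def
    proof (rule L2_bounded[where K="1 * 1"])
      fix z :: "complex ^ 'n" assume z: "z \<in> unit_ball"
      show "cmod (z $ i * of_real (norm z ^ (2 * k))) \<le> 1 * 1"
        unfolding norm_mult using component_le_1[OF z, of i] norm_power_le_1[OF z]
        by (intro mult_mono) (auto simp: norm_power)
    qed simp
    obtain c' where c': "\<And>z. z \<in> unit_ball \<Longrightarrow> commutator (wirtinger i) bergman_projection (f k) z
        = of_real (c' - (I k + real k * A (k - 1)))" and c'_M: "c' * M = A k"
      using commutator_component_norm_power[of i k] unfolding f_def I_def A_def M_def by blast
    define c where "c = c' - (I k + real k * A (k - 1))"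
    have "f k \<in> polynomials"
      unfolding f_def by (rule polynomials_component_norm_power)
    from T[OF this] AE_ball_measure have "AE z in ball_measure. T (f k) z = of_real c"
      by eventually_elim (simp only: c' c_def)
    hence "L2_norm (T (f k)) = cmod (of_real c)"
      by (intro L2_norm_eq_const T_L2 \<open>f k \<in> L2\<close>)
    hence "\<bar>c\<bar> \<le> C * L2_norm (f k)" using C[OF \<open>f k \<in> L2\<close>] by simp
    \<comment> \<open>\<open>C\<close> may have either sign; the absolute value makes the
      multiplication monotone.\<close>
    also have "\<dots> \<le> \<bar>C\<bar> * sqrt (I k)"
      unfolding f_def I_def
      by (intro mult_mono L2_norm_component_norm_power) (auto simp: L2_norm_def)
    finally have "\<bar>c\<bar> \<le> \<bar>C\<bar> * sqrt (I k)" .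
    moreover have "M / 8 \<le> real k * A (k - 1)"
      unfolding M_def A_def by (rule integral_component_norm_power_lower[OF k])
    moreover have "0 \<le> I k" unfolding I_def by simp
    moreover have "c' \<le> I k / M"
    proof -
      have "A k \<le> I k"
        unfolding A_def I_def
      proof (rule integral_mono_AE)
        show "integrable ball_borel (\<lambda>z :: complex ^ 'n. norm z ^ (2 * k))"
          by (rule integrable_ball_bounded[where K=1]) (simp_all add: norm_power_le_1 power_le_one)
        show "AE z :: complex ^ 'n in ball_borel. (cmod (z $ i))\<^sup>2 * norm z ^ (2 * k) \<le> norm z ^ (2 * k)"
          using AE_ball_borel
          by eventually_elim (simp add: component_sq_le_1 mult_left_le_one_le)
      qed (rule integrable_component_norm_power)
      thus ?thesis using M c'_M by (simp add: field_simps)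
    qed
    ultimately show ?thesis unfolding c_def by linarith
  qed
  have "I \<longlonglongrightarrow> 0" unfolding I_def by (rule integral_norm_power_tendsto_0)
  hence "(\<lambda>k. \<bar>C\<bar> * sqrt (I k) + I k / M) \<longlonglongrightarrow> \<bar>C\<bar> * sqrt 0 + 0 / M"
    using M by (intro tendsto_intros) auto
  \<comment> \<open>The comparison starts at index 1, because \<open>bound\<close> holds for
    positive \<open>k\<close>.\<close>
  hence "M / 8 \<le> \<bar>C\<bar> * sqrt 0 + 0 / M"
    by (rule LIMSEQ_le_const) (use bound in \<open>auto intro!: exI[of _ 1]\<close>)
  with M show False by simp
qed

end
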